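(* Let $R\cong M_{n}(D)$ where $n$ is a positive integer and $D$ is a principal ideal V-domain. Then a left $R$-module $M$ is virtually simple if and only if $$M\cong \begin{pmatrix} D/P\\ D/P\\ \vdots\\ D/P\end{pmatrix}$$ (a column with $n$ entries) where $P$ is a maximal left ideal of $D$ or $P=(0)$.
   Context: All rings are associative with identity and all modules are unitary. A left $R$-module $M$ is virtually simple if $M\neq 0$ and $N\cong M$ for every nonzero submodule $N$ of $M$. A ring is a left (resp. right) V-ring if each simple left (resp. right) module over it is injective, and a V-ring if it is both a left and a right V-ring. A principal ideal V-domain is a (not necessarily commutative) domain in which every left ideal and every right ideal is principal and which is a V-ring. $M_n(D)$ is the ring of $n\times n$ matrices over $D$. The column denotes the left $M_n(D)$-module of $n\times 1$ columns with entries in the left $D$-module $D/P$, with the natural matrix multiplication, viewed as a left $R$-module via the isomorphism $R\cong M_n(D)$. *)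

theory Defs
  imports "HOL-Algebra.QuotRing" "HOL-Algebra.Module"
begin

section \<open>Left modules over a not necessarily commutative ring\<close>

text \<open>
  The library locale \<open>module\<close> requires a commutative ring of scalars. The axioms below are
  the same over an arbitrary ring. As in the library, a module record inherits the fields
  \<open>mult\<close> and \<open>one\<close> from \<open>ring\<close>; they play no role and are left \<open>undefined\<close>
  wherever a module is constructed.
\<close>

locale left_module = R?: ring R + M?: abelian_group M
  for R :: "('a, 'r) ring_scheme" (structure)
    and M :: "('a, 'b, 'm) module_scheme" (structure) +
  assumes smult_closed [simp, intro]:
      "\<lbrakk>a \<in> carrier R; x \<in> carrier M\<rbrakk> \<Longrightarrow> a \<odot>\<^bsub>M\<^esub> x \<in> carrier M"
    and smult_l_distr:
      "\<lbrakk>a \<in> carrier R; b \<in> carrier R; x \<in> carrier M\<rbrakk> \<Longrightarrow>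
        (a \<oplus> b) \<odot>\<^bsub>M\<^esub> x = a \<odot>\<^bsub>M\<^esub> x \<oplus>\<^bsub>M\<^esub> b \<odot>\<^bsub>M\<^esub> x"
    and smult_r_distr:
      "\<lbrakk>a \<in> carrier R; x \<in> carrier M; y \<in> carrier M\<rbrakk> \<Longrightarrow>
        a \<odot>\<^bsub>M\<^esub> (x \<oplus>\<^bsub>M\<^esub> y) = a \<odot>\<^bsub>M\<^esub> x \<oplus>\<^bsub>M\<^esub> a \<odot>\<^bsub>M\<^esub> y"
    and smult_assoc1:
      "\<lbrakk>a \<in> carrier R; b \<in> carrier R; x \<in> carrier M\<rbrakk> \<Longrightarrow>
        (a \<otimes> b) \<odot>\<^bsub>M\<^esub> x = a \<odot>\<^bsub>M\<^esub> (b \<odot>\<^bsub>M\<^esub> x)"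
    and smult_one [simp]:
      "x \<in> carrier M \<Longrightarrow> \<one> \<odot>\<^bsub>M\<^esub> x = x"

definition module_hom ::
    "('a, 'r) ring_scheme \<Rightarrow> ('a, 'b, 'm) module_scheme \<Rightarrow> ('a, 'c, 'n) module_scheme
      \<Rightarrow> ('b \<Rightarrow> 'c) set"
  where "module_hom R M N =
    {f \<in> carrier M \<rightarrow> carrier N.
      (\<forall>x\<in>carrier M. \<forall>y\<in>carrier M. f (x \<oplus>\<^bsub>M\<^esub> y) = f x \<oplus>\<^bsub>N\<^esub> f y) \<and>
      (\<forall>a\<in>carrier R. \<forall>x\<in>carrier M. f (a \<odot>\<^bsub>M\<^esub> x) = a \<odot>\<^bsub>N\<^esub> f x)}"

definition isomorphic_modules ::
    "('a, 'r) ring_scheme \<Rightarrow> ('a, 'b, 'm) module_scheme \<Rightarrow> ('a, 'c, 'n) module_scheme \<Rightarrow> bool"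
  where "isomorphic_modules R M N \<longleftrightarrow>
    (\<exists>f\<in>module_hom R M N. bij_betw f (carrier M) (carrier N))"

locale virtually_simple_module = left_module +
  assumes nonzero: "carrier M \<noteq> {\<zero>\<^bsub>M\<^esub>}"
    and submodule_iso:
      "\<lbrakk>submodule N R M; N \<noteq> {\<zero>\<^bsub>M\<^esub>}\<rbrakk> \<Longrightarrow> isomorphic_modules R (M\<lparr>carrier := N\<rparr>) M"

locale simple_module = left_module +
  assumes nonzero: "carrier M \<noteq> {\<zero>\<^bsub>M\<^esub>}"
    and submodule_trivial: "submodule N R M \<Longrightarrow> N = {\<zero>\<^bsub>M\<^esub>} \<or> N = carrier M"


section \<open>Injective modules and V-rings\<close>

text \<open>
  HOL cannot quantify over types inside a formula, so the carrier type \<open>'u\<close> of the test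
  modules \<open>A\<close> and \<open>B\<close> is an explicit parameter.
\<close>

definition injective_module ::
    "'u itself \<Rightarrow> ('a, 'r) ring_scheme \<Rightarrow> ('a, 'e, 'm) module_scheme \<Rightarrow> bool"
  where "injective_module _ R E \<longleftrightarrow> left_module R E \<and>
    (\<forall>(A :: ('a, 'u) module) (B :: ('a, 'u) module).
      left_module R A \<longrightarrow> left_module R B \<longrightarrow>
      (\<forall>f\<in>module_hom R A B. inj_on f (carrier A) \<longrightarrow>
        (\<forall>g\<in>module_hom R A E. \<exists>h\<in>module_hom R B E. \<forall>x\<in>carrier A. h (f x) = g x)))"

text \<open>
  For a ring with elements in \<open>'a\<close>, carriers of type \<open>'a set\<close> lose no generality in the
  next definition. Every simple module is isomorphic to \<open>R/L\<close> for a maximal left ideal \<open>L\<close>,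
  whose elements are cosets, hence of type \<open>'a set\<close>. The test modules of type \<open>'a set\<close>
  include copies (via singletons) of the inclusion of every left ideal into \<open>R\<close>, so by
  Baer's criterion they detect injectivity among modules of any carrier type.
\<close>

definition left_V_ring :: "('a, 'r) ring_scheme \<Rightarrow> bool"
  where "left_V_ring R \<longleftrightarrow> ring R \<and>
    (\<forall>S :: ('a, 'a set) module. simple_module R S \<longrightarrow> injective_module TYPE('a set) R S)"

definition opposite_ring :: "('a, 'r) ring_scheme \<Rightarrow> ('a, 'r) ring_scheme"
  where "opposite_ring R = R\<lparr>mult := \<lambda>x y. y \<otimes>\<^bsub>R\<^esub> x\<rparr>"

text \<open>Right modules over \<open>R\<close> are left modules over the opposite ring.\<close>

definition right_V_ring :: "('a, 'r) ring_scheme \<Rightarrow> bool"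
  where "right_V_ring R \<longleftrightarrow> left_V_ring (opposite_ring R)"

definition V_ring :: "('a, 'r) ring_scheme \<Rightarrow> bool"
  where "V_ring R \<longleftrightarrow> left_V_ring R \<and> right_V_ring R"


section \<open>One-sided ideals and principal ideal V-domains\<close>

locale left_ideal = additive_subgroup I R + ring R for I and R (structure) +
  assumes l_closed: "\<lbrakk>x \<in> I; a \<in> carrier R\<rbrakk> \<Longrightarrow> a \<otimes> x \<in> I"

locale right_ideal = additive_subgroup I R + ring R for I and R (structure) +
  assumes r_closed: "\<lbrakk>x \<in> I; a \<in> carrier R\<rbrakk> \<Longrightarrow> x \<otimes> a \<in> I"

locale maximal_left_ideal = left_ideal +
  assumes not_carrier: "I \<noteq> carrier R"
    and maximal: "\<lbrakk>left_ideal J R; I \<subseteq> J\<rbrakk> \<Longrightarrow> J = I \<or> J = carrier R"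

text \<open>The library locale \<open>domain\<close> is commutative, and \<open>principal_domain\<close> builds on it.\<close>

locale noncomm_domain = ring +
  assumes one_not_zero: "\<one> \<noteq> \<zero>"
    and integral:
      "\<lbrakk>a \<otimes> b = \<zero>; a \<in> carrier R; b \<in> carrier R\<rbrakk> \<Longrightarrow> a = \<zero> \<or> b = \<zero>"

locale principal_ideal_V_domain = noncomm_domain +
  assumes left_principal:
      "left_ideal I R \<Longrightarrow> \<exists>x\<in>carrier R. I = {a \<otimes> x | a. a \<in> carrier R}"
    and right_principal:
      "right_ideal I R \<Longrightarrow> \<exists>x\<in>carrier R. I = {x \<otimes> a | a. a \<in> carrier R}"
    and V_ring: "V_ring R"


section \<open>Matrix rings, the quotient \<open>D/P\<close> and its columns\<close>

definition matrix_ring :: "nat \<Rightarrow> ('d, 'r) ring_scheme \<Rightarrow> (nat \<Rightarrow> nat \<Rightarrow> 'd) ring"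
  where "matrix_ring n D =
    \<lparr>carrier = {..<n} \<rightarrow>\<^sub>E ({..<n} \<rightarrow>\<^sub>E carrier D),
     mult = (\<lambda>A B. \<lambda>i\<in>{..<n}. \<lambda>j\<in>{..<n}. \<Oplus>\<^bsub>D\<^esub>k\<in>{..<n}. A i k \<otimes>\<^bsub>D\<^esub> B k j),
     one = (\<lambda>i\<in>{..<n}. \<lambda>j\<in>{..<n}. if i = j then \<one>\<^bsub>D\<^esub> else \<zero>\<^bsub>D\<^esub>),
     zero = (\<lambda>i\<in>{..<n}. \<lambda>j\<in>{..<n}. \<zero>\<^bsub>D\<^esub>),
     add = (\<lambda>A B. \<lambda>i\<in>{..<n}. \<lambda>j\<in>{..<n}. A i j \<oplus>\<^bsub>D\<^esub> B i j)\<rparr>"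

text \<open>
  The left module \<open>D/P\<close> for a left ideal \<open>P\<close>. For a coset \<open>X = P + x\<close>, all the cosets
  \<open>P + a x'\<close> with \<open>x'\<close> in \<open>X\<close> coincide, so the union below is the coset \<open>P + a x\<close>
  (the library's \<open>rcoset_mult\<close> is defined in the same way).
\<close>

definition left_quotient :: "('d, 'r) ring_scheme \<Rightarrow> 'd set \<Rightarrow> ('d, 'd set) module"
  where "left_quotient D P =
    \<lparr>carrier = a_rcosets\<^bsub>D\<^esub> P,
     mult = undefined,
     one = undefined,
     zero = P,
     add = set_add D,
     smult = (\<lambda>a X. \<Union>x\<in>X. P +>\<^bsub>D\<^esub> (a \<otimes>\<^bsub>D\<^esub> x))\<rparr>"

definition column_module ::
    "nat \<Rightarrow> ('d, 'b, 'm) module_scheme \<Rightarrow> (nat \<Rightarrow> nat \<Rightarrow> 'd, nat \<Rightarrow> 'b) module"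
  where "column_module n M =
    \<lparr>carrier = {..<n} \<rightarrow>\<^sub>E carrier M,
     mult = undefined,
     one = undefined,
     zero = (\<lambda>i\<in>{..<n}. \<zero>\<^bsub>M\<^esub>),
     add = (\<lambda>v w. \<lambda>i\<in>{..<n}. v i \<oplus>\<^bsub>M\<^esub> w i),
     smult = (\<lambda>A v. \<lambda>i\<in>{..<n}. \<Oplus>\<^bsub>M\<^esub>k\<in>{..<n}. A i k \<odot>\<^bsub>M\<^esub> v k)\<rparr>"

definition restrict_scalars ::
    "('r \<Rightarrow> 's) \<Rightarrow> ('s, 'b, 'm) module_scheme \<Rightarrow> ('r, 'b) module"
  where "restrict_scalars \<phi> M =
    \<lparr>carrier = carrier M,
     mult = undefined,
     one = undefined,
     zero = \<zero>\<^bsub>M\<^esub>,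
     add = add M,
     smult = (\<lambda>r x. \<phi> r \<odot>\<^bsub>M\<^esub> x)\<rparr>"

end

theory Submission
  imports Defs
begin

text \<open>
  Let \<open>e\<close> be the corner idempotent of \<open>E = M\<^sub>n(D)\<close>. If \<open>m = e m\<close>, then \<open>E m\<close> is the column module
  of \<open>D/J\<close>, where \<open>J\<close> is the annihilator of \<open>m\<close> in \<open>D \<cong> e E e\<close>. A virtually simple \<open>M\<close> contains
  such an \<open>m \<noteq> 0\<close> and is isomorphic to \<open>E m\<close>. Write \<open>J = D c\<close>. If \<open>c \<noteq> 0\<close>, choose a maximal right
  ideal \<open>a D\<close> containing \<open>c\<close>, say \<open>c = a y\<close>: then \<open>D a\<close> is a maximal left ideal and is the
  annihilator of \<open>y m \<noteq> 0\<close>, so \<open>M \<cong> E y m\<close> is the column of \<open>D/D a\<close>. Conversely, a nonzero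
  submodule of the column of \<open>D/P\<close> consists of the columns with entries in \<open>I/P\<close> for some left
  ideal \<open>I = D c\<close> with \<open>P \<subset> I\<close>. It is generated by \<open>(c + P, 0, \<dots>, 0)\<close>, where \<open>c\<close> can be chosen
  so that the annihilator of this element is again \<open>P\<close>.
\<close>

section \<open>Module isomorphisms and restriction of scalars\<close>

lemma module_homD:
  assumes "f \<in> module_hom R M N"
  shows "x \<in> carrier M \<Longrightarrow> f x \<in> carrier N"
    and "x \<in> carrier M \<Longrightarrow> y \<in> carrier M \<Longrightarrow> f (x \<oplus>\<^bsub>M\<^esub> y) = f x \<oplus>\<^bsub>N\<^esub> f y"
    and "a \<in> carrier R \<Longrightarrow> x \<in> carrier M \<Longrightarrow> f (a \<odot>\<^bsub>M\<^esub> x) = a \<odot>\<^bsub>N\<^esub> f x"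
  using assms by (auto simp: module_hom_def)

text \<open>Both targets are the quotient of \<open>A\<close> by one and the same congruence, so
  sending \<open>f x\<close> to \<open>g x\<close> is well defined and bijective. Working with bare
  records makes this applicable to columns before the module axioms are verified for them.\<close>

lemma isomorphic_modules_if_same_kernel:
  assumes f: "f \<in> module_hom R A B" "f ` carrier A = carrier B"
    and g: "g \<in> module_hom R A C" "g ` carrier A = carrier C"
    and closed: "\<And>x y. x \<in> carrier A \<Longrightarrow> y \<in> carrier A \<Longrightarrow> x \<oplus>\<^bsub>A\<^esub> y \<in> carrier A"
      "\<And>a x. a \<in> carrier R \<Longrightarrow> x \<in> carrier A \<Longrightarrow> a \<odot>\<^bsub>A\<^esub> x \<in> carrier A"
    and same: "\<And>x y. x \<in> carrier A \<Longrightarrow> y \<in> carrier A \<Longrightarrow> f x = f y \<longleftrightarrow> g x = g y"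
  shows "isomorphic_modules R B C"
proof -
  define h where "h b = g (inv_into (carrier A) f b)" for b
  have h: "h (f x) = g x" if "x \<in> carrier A" for x
    unfolding h_def using that same f_inv_into_f[of "f x" f "carrier A"] inv_into_into[of "f x" f "carrier A"]
    by blast
  have "h \<in> module_hom R B C"
    unfolding module_hom_def
  proof (intro CollectI conjI ballI funcsetI)
    fix x assume "x \<in> carrier B"
    then obtain u where u: "u \<in> carrier A" "x = f u" using f(2) by blast
    show "h x \<in> carrier C" using u h g(2) by auto
    fix a assume a: "a \<in> carrier R"
    show "h (a \<odot>\<^bsub>B\<^esub> x) = a \<odot>\<^bsub>C\<^esub> h x"
      using u a closed h by (metis module_homD(3) f(1) g(1))
  next
    fix x y assume "x \<in> carrier B" "y \<in> carrier B"
    then obtain u w where u: "u \<in> carrier A" "x = f u" and w: "w \<in> carrier A" "y = f w"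
      using f(2) by blast
    then show "h (x \<oplus>\<^bsub>B\<^esub> y) = h x \<oplus>\<^bsub>C\<^esub> h y"
      using closed h by (metis module_homD(2) f(1) g(1))
  qed
  moreover have "bij_betw h (carrier B) (carrier C)"
    unfolding bij_betw_def
  proof
    show "inj_on h (carrier B)"
      using f(2) h same by (auto simp: inj_on_def f(2)[symmetric])
    show "h ` carrier B = carrier C"
      using h by (auto simp: f(2)[symmetric] g(2)[symmetric] image_image)
  qed
  ultimately show ?thesis unfolding isomorphic_modules_def by blast
qed

text \<open>The preceding lemma compares \<open>f\<close> with the identity of \<open>M\<close>;
  injectivity of \<open>f\<close> makes the fibres agree.\<close>

lemma isomorphic_modules_sym:
  assumes iso: "isomorphic_modules R M N"
    and closed: "\<And>x y. x \<in> carrier M \<Longrightarrow> y \<in> carrier M \<Longrightarrow> x \<oplus>\<^bsub>M\<^esub> y \<in> carrier M"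
      "\<And>a x. a \<in> carrier R \<Longrightarrow> x \<in> carrier M \<Longrightarrow> a \<odot>\<^bsub>M\<^esub> x \<in> carrier M"
  shows "isomorphic_modules R N M"
proof -
  obtain f where f: "f \<in> module_hom R M N" "bij_betw f (carrier M) (carrier N)"
    using iso unfolding isomorphic_modules_def by blast
  have "(\<lambda>x. x) \<in> module_hom R M M" by (auto simp: module_hom_def)
  then show ?thesis
    using f closed by (intro isomorphic_modules_if_same_kernel[where f = f and g = "\<lambda>x. x"])
      (auto simp: bij_betw_def inj_on_def)
qed

lemma isomorphic_modules_trans:
  assumes "isomorphic_modules R A B" "isomorphic_modules R B C"
  shows "isomorphic_modules R A C"
proof -
  obtain f g where f: "f \<in> module_hom R A B" "bij_betw f (carrier A) (carrier B)"
    and g: "g \<in> module_hom R B C" "bij_betw g (carrier B) (carrier C)"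
    using assms unfolding isomorphic_modules_def by blast
  have "g \<circ> f \<in> module_hom R A C"
    using module_homD[OF f(1)] module_homD[OF g(1)] unfolding module_hom_def by simp
  then show ?thesis
    unfolding isomorphic_modules_def using bij_betw_trans[OF f(2) g(2)] by blast
qed

section \<open>Scalar multiplication and cyclic submodules\<close>

context left_module
begin

lemma zero_smult [simp]:
  assumes "x \<in> carrier M" shows "\<zero> \<odot>\<^bsub>M\<^esub> x = \<zero>\<^bsub>M\<^esub>"
  using smult_l_distr[of \<zero> \<zero> x] assms by (metis M.add.l_cancel_one' R.zero_closed R.l_zero smult_closed)

lemma smult_zero [simp]:
  assumes "a \<in> carrier R" shows "a \<odot>\<^bsub>M\<^esub> \<zero>\<^bsub>M\<^esub> = \<zero>\<^bsub>M\<^esub>"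
  using smult_r_distr[of a "\<zero>\<^bsub>M\<^esub>" "\<zero>\<^bsub>M\<^esub>"] assms by (metis M.add.l_cancel_one' M.zero_closed M.l_zero smult_closed)

lemma minus_smult:
  assumes "a \<in> carrier R" "x \<in> carrier M"
  shows "(\<ominus> a) \<odot>\<^bsub>M\<^esub> x = \<ominus>\<^bsub>M\<^esub> (a \<odot>\<^bsub>M\<^esub> x)"
  using smult_l_distr[of "\<ominus> a" a x] assms
  by (metis M.minus_equality R.a_inv_closed R.l_neg smult_closed zero_smult)

lemma cyclic_submodule:
  assumes x: "x \<in> carrier M"
  shows "submodule {a \<odot>\<^bsub>M\<^esub> x | a. a \<in> carrier R} R M"
proof -
  have "\<one>\<^bsub>add_monoid M\<^esub> = \<zero> \<odot>\<^bsub>M\<^esub> x" using x by simp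
  moreover have "inv\<^bsub>add_monoid M\<^esub> (a \<odot>\<^bsub>M\<^esub> x) = (\<ominus> a) \<odot>\<^bsub>M\<^esub> x" if "a \<in> carrier R" for a
    using minus_smult[OF that x] by (simp add: a_inv_def)
  ultimately show ?thesis
    using x
    by (unfold_locales) (force simp: smult_l_distr[symmetric] smult_assoc1[symmetric])+
qed

lemma iso_submodule_sym:
  assumes "submodule N R M" "isomorphic_modules R (M\<lparr>carrier := N\<rparr>) M"
  shows "isomorphic_modules R M (M\<lparr>carrier := N\<rparr>)"
proof -
  interpret N: submodule N R M by fact
  show ?thesis
    using N.m_closed N.smult_closed by (intro isomorphic_modules_sym[OF assms(2)]) auto
qed

text \<open>The submodule generated by \<open>x\<close> contains 1 x = x, hence is nonzero, and
  virtual simplicity applies to it.\<close>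

lemma virtually_simple_iso_cyclic:
  assumes "virtually_simple_module R M" "x \<in> carrier M" "x \<noteq> \<zero>\<^bsub>M\<^esub>"
  shows "isomorphic_modules R M (M\<lparr>carrier := {a \<odot>\<^bsub>M\<^esub> x | a. a \<in> carrier R}\<rparr>)"
proof -
  have "x \<in> {a \<odot>\<^bsub>M\<^esub> x | a. a \<in> carrier R}"
    using R.one_closed smult_one[OF assms(2), symmetric] by blast
  then show ?thesis
    using virtually_simple_module.submodule_iso[OF assms(1) cyclic_submodule] assms(2,3)
      iso_submodule_sym[OF cyclic_submodule[OF assms(2)]] by blast
qed

end

section \<open>Restriction of scalars along a surjective ring homomorphism\<close>

lemma module_hom_restrict_scalars:
  assumes "\<psi> ` carrier S = carrier R"
  shows "module_hom S (restrict_scalars \<psi> A) (restrict_scalars \<psi> B) = module_hom R A B"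
  unfolding module_hom_def restrict_scalars_def assms[symmetric] by auto

lemma submodule_restrict_scalars:
  assumes "\<psi> ` carrier S = carrier R"
  shows "submodule N S (restrict_scalars \<psi> M) \<longleftrightarrow> submodule N R M"
proof -
  have "subgroup N (add_monoid (restrict_scalars \<psi> M)) \<longleftrightarrow> subgroup N (add_monoid M)"
    by (auto simp: subgroup_def restrict_scalars_def m_inv_def)
  then show ?thesis
    unfolding submodule_def submodule_axioms_def assms[symmetric]
    by (auto simp: restrict_scalars_def)
qed

lemma (in left_module) left_module_restrict_scalars:
  assumes "\<psi> \<in> ring_hom S R" "ring S"
  shows "left_module S (restrict_scalars \<psi> M)"
proof -
  interpret S: ring S by fact
  have "abelian_group (restrict_scalars \<psi> M)"
    by (rule abelian_groupI)
      (auto simp: restrict_scalars_def M.a_ac intro: bexI[of _ "\<ominus>\<^bsub>M\<^esub> _"] M.l_neg)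
  then show ?thesis
    using assms ring_hom_memE[OF assms(1)]
    by (intro left_module.intro left_module_axioms.intro)
      (auto simp: restrict_scalars_def smult_l_distr smult_r_distr smult_assoc1)
qed

text \<open>Surjectivity of \<open>\<psi>\<close> gives the same submodules and the same
  homomorphisms over \<open>S\<close> and over \<open>R\<close>, so the whole argument can be run
  over the matrix ring.\<close>

lemma (in left_module) virtually_simple_restrict_scalars:
  assumes "\<psi> \<in> ring_hom S R" "ring S" "\<psi> ` carrier S = carrier R"
  shows "virtually_simple_module S (restrict_scalars \<psi> M) \<longleftrightarrow> virtually_simple_module R M"
proof -
  have "(restrict_scalars \<psi> M)\<lparr>carrier := N\<rparr> = restrict_scalars \<psi> (M\<lparr>carrier := N\<rparr>)" for N
    by (simp add: restrict_scalars_def)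
  then have "isomorphic_modules S ((restrict_scalars \<psi> M)\<lparr>carrier := N\<rparr>) (restrict_scalars \<psi> M)
    \<longleftrightarrow> isomorphic_modules R (M\<lparr>carrier := N\<rparr>) M" for N
    unfolding isomorphic_modules_def
    by (simp add: module_hom_restrict_scalars[OF assms(3)]) (simp add: restrict_scalars_def)
  then show ?thesis
    using left_module_restrict_scalars[OF assms(1,2)] left_module_axioms
    unfolding virtually_simple_module_def virtually_simple_module_axioms_def
      submodule_restrict_scalars[OF assms(3)]
    by (simp add: restrict_scalars_def)
qed

section \<open>Ideals\<close>

lemma (in ring) minus_eq_zero_iff [simp]:
  assumes "a \<in> carrier R" "b \<in> carrier R"
  shows "a \<ominus> b = \<zero> \<longleftrightarrow> a = b"
  using assms minus_equality[of a "\<ominus> b"] by (auto simp: minus_eq r_neg)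

text \<open>Negatives are obtained as left multiples by \<open>\<ominus> \<one>\<close>.\<close>

lemma (in ring) left_idealI:
  assumes "I \<subseteq> carrier R" "\<zero> \<in> I" "\<And>x y. x \<in> I \<Longrightarrow> y \<in> I \<Longrightarrow> x \<oplus> y \<in> I"
    "\<And>a x. a \<in> carrier R \<Longrightarrow> x \<in> I \<Longrightarrow> a \<otimes> x \<in> I"
  shows "left_ideal I R"
proof -
  have "\<ominus> x \<in> I" if "x \<in> I" for x
    using assms(4)[of "\<ominus> \<one>" x] that assms(1) by (simp add: l_minus subset_iff)
  then show ?thesis
    using assms
    by (intro left_ideal.intro additive_subgroup.intro left_ideal_axioms.intro add.subgroupI ring_axioms)
      (auto simp: a_inv_def[symmetric])
qed

lemma (in ring) right_idealI:
  assumes "I \<subseteq> carrier R" "\<zero> \<in> I" "\<And>x y. x \<in> I \<Longrightarrow> y \<in> I \<Longrightarrow> x \<oplus> y \<in> I"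
    "\<And>a x. a \<in> carrier R \<Longrightarrow> x \<in> I \<Longrightarrow> x \<otimes> a \<in> I"
  shows "right_ideal I R"
proof -
  have "\<ominus> x \<in> I" if "x \<in> I" for x
    using assms(4)[of "\<ominus> \<one>" x] that assms(1) by (simp add: r_minus subset_iff)
  then show ?thesis
    using assms
    by (intro right_ideal.intro additive_subgroup.intro right_ideal_axioms.intro add.subgroupI ring_axioms)
      (auto simp: a_inv_def[symmetric])
qed

lemma (in ring) left_ideal_principal:
  assumes "x \<in> carrier R" shows "left_ideal {a \<otimes> x | a. a \<in> carrier R} R" (is "left_ideal ?I R")
proof (rule left_idealI)
  show "?I \<subseteq> carrier R" using assms by blast
  show "\<zero> \<in> ?I" using assms l_null[symmetric] by blast
  show "u \<oplus> v \<in> ?I" if "u \<in> ?I" "v \<in> ?I" for u v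
    using that assms l_distr[symmetric] by blast
  show "b \<otimes> u \<in> ?I" if "b \<in> carrier R" "u \<in> ?I" for b u
    using that assms m_assoc[symmetric] by blast
qed

lemma (in ring) right_ideal_principal:
  assumes "x \<in> carrier R" shows "right_ideal {x \<otimes> a | a. a \<in> carrier R} R" (is "right_ideal ?I R")
proof (rule right_idealI)
  show "?I \<subseteq> carrier R" using assms by blast
  show "\<zero> \<in> ?I" using assms r_null[symmetric] by blast
  show "u \<oplus> v \<in> ?I" if "u \<in> ?I" "v \<in> ?I" for u v
    using that assms r_distr[symmetric] by blast
  show "u \<otimes> b \<in> ?I" if "b \<in> carrier R" "u \<in> ?I" for b u
    using that assms m_assoc by blast
qed

lemma (in left_ideal) abelian_subgroup: "abelian_subgroup I R"
  by (simp add: abelian_subgroupI3 is_abelian_group additive_subgroup_axioms)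

text \<open>Zorn's lemma for the right ideals above \<open>K\<close> that miss
  \<open>\<one>\<close>: properness tested on a single element survives unions of chains.\<close>

lemma (in ring) maximal_right_ideal_exists:
  assumes K: "right_ideal K R" "\<one> \<notin> K"
  obtains I where "right_ideal I R" "K \<subseteq> I" "\<one> \<notin> I"
    "\<And>J. right_ideal J R \<Longrightarrow> I \<subseteq> J \<Longrightarrow> \<one> \<notin> J \<Longrightarrow> J = I"
proof -
  define \<A> where "\<A> = {I. right_ideal I R \<and> K \<subseteq> I \<and> \<one> \<notin> I}"
  have "\<exists>I\<in>\<A>. \<forall>J\<in>\<A>. I \<subseteq> J \<longrightarrow> J = I"
  proof (rule subset_Zorn_nonempty)
    show "\<A> \<noteq> {}" using K by (auto simp: \<A>_def)
    fix \<C> assume ne: "\<C> \<noteq> {}" and ch: "subset.chain \<A> \<C>"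
    have mem: "right_ideal I R" "K \<subseteq> I" "\<one> \<notin> I" if "I \<in> \<C>" for I
      using ch that by (auto simp: \<A>_def subset_chain_def)
    have "right_ideal (\<Union>\<C>) R"
    proof (rule right_idealI)
      show "\<Union>\<C> \<subseteq> carrier R"
        using mem(1) additive_subgroup.a_subset right_ideal.axioms(1) by blast
      show "\<zero> \<in> \<Union>\<C>"
        using mem(1) ne additive_subgroup.zero_closed right_ideal.axioms(1) by blast
      show "x \<otimes> a \<in> \<Union>\<C>" if "a \<in> carrier R" "x \<in> \<Union>\<C>" for a x
        using that right_ideal.r_closed[OF mem(1)] by blast
      fix x y assume "x \<in> \<Union>\<C>" "y \<in> \<Union>\<C>"
      then obtain I J where "I \<in> \<C>" "J \<in> \<C>" "x \<in> I" "y \<in> J" by blast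
      moreover from this have "I \<subseteq> J \<or> J \<subseteq> I" using ch by (auto simp: subset_chain_def)
      ultimately obtain L where "L \<in> \<C>" "x \<in> L" "y \<in> L" by blast
      then show "x \<oplus> y \<in> \<Union>\<C>"
        using additive_subgroup.a_closed[OF right_ideal.axioms(1)[OF mem(1)]] by blast
    qed
    then show "\<Union>\<C> \<in> \<A>" using mem ne unfolding \<A>_def by blast
  qed
  then show ?thesis using that by (auto simp: \<A>_def)
qed

section \<open>Units, cancellation and factorization in noncommutative domains\<close>

lemma (in noncomm_domain) inverse_commute:
  assumes "a \<in> carrier R" "b \<in> carrier R" "a \<otimes> b = \<one>"
  shows "b \<otimes> a = \<one>"
proof -
  \<comment> \<open>(b a - 1) b = b (a b) - b = 0, and \<open>b\<close> is nonzero because a b =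
    1.\<close>
  have "(b \<otimes> a \<ominus> \<one>) \<otimes> b = \<zero>"
    using assms by (simp add: minus_eq l_distr m_assoc l_minus r_neg)
  moreover have "b \<noteq> \<zero>" using assms one_not_zero by auto
  ultimately have "b \<otimes> a \<ominus> \<one> = \<zero>" using integral[of "b \<otimes> a \<ominus> \<one>" b] assms by auto
  then show ?thesis using assms by simp
qed

lemma (in noncomm_domain) right_cancel:
  assumes "a \<in> carrier R" "b \<in> carrier R" "c \<in> carrier R" "c \<noteq> \<zero>" "a \<otimes> c = b \<otimes> c"
  shows "a = b"
proof -
  have "(a \<ominus> b) \<otimes> c = \<zero>" using assms by (simp add: minus_eq l_distr l_minus r_neg)
  then show ?thesis using assms integral[of "a \<ominus> b" c] by auto
qed

lemma (in noncomm_domain) left_cancel: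
  assumes "a \<in> carrier R" "b \<in> carrier R" "c \<in> carrier R" "c \<noteq> \<zero>" "c \<otimes> a = c \<otimes> b"
  shows "a = b"
proof -
  have "c \<otimes> (a \<ominus> b) = \<zero>" using assms by (simp add: minus_eq r_distr r_minus r_neg)
  then show ?thesis using assms integral[of c "a \<ominus> b"] by auto
qed

text \<open>A maximal right ideal above x R is principal, say a R, which gives x = a y.
  Irreducibility of \<open>a\<close> is left-right symmetric, hence R a is a maximal left ideal.
  Finally y = b x = b a y would make \<open>a\<close> a unit.\<close>

lemma (in principal_ideal_V_domain) irreducible_left_factor:
  assumes x: "x \<in> carrier R" "x \<noteq> \<zero>" and nonunit: "\<one> \<notin> {b \<otimes> x | b. b \<in> carrier R}"
  obtains a y where "a \<in> carrier R" "y \<in> carrier R" "x = a \<otimes> y"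
    "maximal_left_ideal {b \<otimes> a | b. b \<in> carrier R} R" "y \<notin> {b \<otimes> x | b. b \<in> carrier R}"
proof -
  \<comment> \<open>One-sided inverses are two-sided, so \<open>x\<close> without a left inverse has
    no right inverse either.\<close>
  have "\<one> \<notin> {x \<otimes> b | b. b \<in> carrier R}"
    using inverse_commute[OF x(1)] nonunit by fastforce
  then obtain K where K: "right_ideal K R" "{x \<otimes> b | b. b \<in> carrier R} \<subseteq> K" "\<one> \<notin> K"
    and K_max: "\<And>J. right_ideal J R \<Longrightarrow> K \<subseteq> J \<Longrightarrow> \<one> \<notin> J \<Longrightarrow> J = K"
    using maximal_right_ideal_exists[OF right_ideal_principal[OF x(1)]] by blast
  obtain a where a: "a \<in> carrier R" and K_eq: "K = {a \<otimes> b | b. b \<in> carrier R}"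
    using right_principal[OF K(1)] by blast
  have "x \<in> K" using K(2) x(1) r_one[OF x(1), symmetric] by blast
  then obtain y where y: "y \<in> carrier R" "x = a \<otimes> y" using K_eq by blast
  have a0: "a \<noteq> \<zero>" and y0: "y \<noteq> \<zero>" using x y a by auto
  have no_inv: "\<one> \<noteq> b \<otimes> a" if "b \<in> carrier R" for b
    using inverse_commute[OF that a] K(3) K_eq that by fastforce
  have "maximal_left_ideal {b \<otimes> a | b. b \<in> carrier R} R"
  proof (rule maximal_left_ideal.intro[OF left_ideal_principal[OF a]], rule maximal_left_ideal_axioms.intro)
    show "{b \<otimes> a | b. b \<in> carrier R} \<noteq> carrier R"
    proof
      assume "{b \<otimes> a | b. b \<in> carrier R} = carrier R"
      then have "\<one> \<in> {b \<otimes> a | b. b \<in> carrier R}" by simp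
      then show False using no_inv by blast
    qed
    fix J assume J: "left_ideal J R" and sub: "{b \<otimes> a | b. b \<in> carrier R} \<subseteq> J"
    obtain c where c: "c \<in> carrier R" and J_eq: "J = {b \<otimes> c | b. b \<in> carrier R}"
      using left_principal[OF J] by blast
    have "a \<in> J" using sub a l_one[OF a, symmetric] by blast
    then obtain b where b: "b \<in> carrier R" and abc: "a = b \<otimes> c" using J_eq by blast
    \<comment> \<open>The factorization a = b c gives a R \<subseteq> b R, so by maximality b R is
      all of R or \<open>K\<close> itself. In the first case \<open>b\<close> is a unit, in the
      second \<open>c\<close> is.\<close>
    have bK: "K \<subseteq> {b \<otimes> d | d. d \<in> carrier R}"
      using K_eq abc b c m_assoc by auto
    show "J = {b \<otimes> a | b. b \<in> carrier R} \<or> J = carrier R"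
    proof (cases "\<one> \<in> {b \<otimes> d | d. d \<in> carrier R}")
      case True
      then obtain b' where b': "b' \<in> carrier R" "b \<otimes> b' = \<one>" by auto
      have "c = b' \<otimes> a"
        using inverse_commute[OF b b'] abc b b' c by (simp add: m_assoc[symmetric])
      then have "J \<subseteq> {b \<otimes> a | b. b \<in> carrier R}"
        using J_eq a b' by (auto simp: m_assoc[symmetric])
      then show ?thesis using sub by blast
    next
      case False
      then have "b \<in> K" using K_max[OF right_ideal_principal[OF b] bK] b r_one[OF b, symmetric] by blast
      then obtain u where u: "u \<in> carrier R" "b = a \<otimes> u" using K_eq by blast
      have "a \<otimes> (u \<otimes> c) = a" using m_assoc[OF a u(1) c] u(2) abc by metis
      then have "u \<otimes> c = \<one>"
        using left_cancel[of "u \<otimes> c" \<one> a] a a0 u(1) c by simp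
      then have "d = (d \<otimes> u) \<otimes> c" if "d \<in> carrier R" for d
        using that u(1) c by (simp add: m_assoc)
      then have "carrier R \<subseteq> J" using u m_closed J_eq by blast
      then show ?thesis using additive_subgroup.a_subset[OF left_ideal.axioms(1)[OF J]] by blast
    qed
  qed
  moreover have "y \<notin> {b \<otimes> x | b. b \<in> carrier R}"
  proof
    assume "y \<in> {b \<otimes> x | b. b \<in> carrier R}"
    then obtain b where b: "b \<in> carrier R" "y = b \<otimes> x" by blast
    then have "\<one> = b \<otimes> a"
      using right_cancel[of \<one> "b \<otimes> a" y] a y y0 by (simp add: m_assoc)
    then show False using no_inv b by blast
  qed
  ultimately show ?thesis using that a y by blast
qed

lemma (in left_ideal) proper_iff: "I \<noteq> carrier R \<longleftrightarrow> \<one> \<notin> I"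
proof
  assume "I \<noteq> carrier R"
  then obtain a where a: "a \<in> carrier R" "a \<notin> I" using a_subset by blast
  then show "\<one> \<notin> I" using l_closed[of \<one> a] by auto
qed auto

text \<open>The set of \<open>d\<close> with d c in \<open>P\<close> is the annihilator of c + P, so
  I/P is cyclic on a generator with annihilator \<open>P\<close>. For maximal \<open>P\<close> the
  ideal \<open>I\<close> is the whole ring and c = 1 works; for P = 0 every generator does, by the
  absence of zero divisors.\<close>

lemma (in principal_ideal_V_domain) zero_or_maximal_generator:
  assumes P: "maximal_left_ideal P R \<or> P = {\<zero>}" and I: "left_ideal I R" and sub: "P \<subset> I"
  shows "\<exists>c\<in>carrier R. I = {b \<otimes> c | b. b \<in> carrier R} \<and> {d \<in> carrier R. d \<otimes> c \<in> P} = P"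
  using P
proof
  assume "maximal_left_ideal P R"
  then interpret maximal_left_ideal P R .
  have "I = carrier R" using maximal[OF I] sub by blast
  then show ?thesis using a_subset by (intro bexI[of _ \<one>]) (auto, metis r_one)
next
  assume P0: "P = {\<zero>}"
  obtain c where c: "c \<in> carrier R" "I = {b \<otimes> c | b. b \<in> carrier R}" using left_principal[OF I] by blast
  have "c \<noteq> \<zero>" using c sub P0 by auto
  then have "{d \<in> carrier R. d \<otimes> c \<in> P} = P" using integral[of _ c] c P0 by auto
  then show ?thesis using c by blast
qed

section \<open>Quotients and columns\<close>

context left_ideal
begin

sublocale abelian_subgroup I R
  by (rule abelian_subgroup)

lemma coset_eq_iff:
  assumes "a \<in> carrier R" "b \<in> carrier R"
  shows "I +> a = I +> b \<longleftrightarrow> a \<ominus> b \<in> I"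
  using a_repr_independence'[of a b] a_repr_independenceD[of a b] a_rcos_module[of b a] assms
  by (auto simp: minus_eq)

lemma left_quotient_add:
  assumes "a \<in> carrier R" "b \<in> carrier R"
  shows "(I +> a) \<oplus>\<^bsub>left_quotient R I\<^esub> (I +> b) = I +> (a \<oplus> b)"
  using assms by (simp add: left_quotient_def a_rcos_sum)

lemma left_quotient_smult:
  assumes "a \<in> carrier R" "b \<in> carrier R"
  shows "a \<odot>\<^bsub>left_quotient R I\<^esub> (I +> b) = I +> (a \<otimes> b)"
proof -
  have "I +> (a \<otimes> x) = I +> (a \<otimes> b)" if x: "x \<in> I +> b" for x
  proof -
    have xc: "x \<in> carrier R" using x assms(2) a_r_coset_subset_G[OF a_subset] by blast
    have "x \<ominus> b \<in> I" using a_rcos_module[OF assms(2) xc] x by (simp add: minus_eq)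
    then have "a \<otimes> (x \<ominus> b) \<in> I" using l_closed assms(1) by blast
    then show ?thesis
      using coset_eq_iff[of "a \<otimes> x" "a \<otimes> b"] assms xc by (simp add: minus_eq r_distr r_minus)
  qed
  then have "(\<Union>x\<in>I +> b. I +> (a \<otimes> x)) = (\<Union>x\<in>I +> b. I +> (a \<otimes> b))"
    by (rule SUP_cong[OF refl])
  \<comment> \<open>The coset is nonempty, so the union of this constant family is its single
    value.\<close>
  then show ?thesis
    using a_rcos_self[OF assms(2)] unfolding left_quotient_def by auto
qed

lemma abelian_monoid_left_quotient: "abelian_monoid (left_quotient R I)"
proof -
  interpret Q: comm_group "R A_Mod I" by (rule a_factorgroup_is_comm_group)
  show ?thesis
    using Q.m_closed Q.one_closed Q.m_assoc Q.m_comm Q.l_one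
    by (intro abelian_monoidI) (simp_all add: A_FactGroup_def' left_quotient_def)
qed

text \<open>Used because the matrix action on columns of cosets is defined by sums inside the
  quotient.\<close>

lemma left_quotient_finsum:
  assumes "finite A" "f \<in> A \<rightarrow> carrier R"
  shows "(\<Oplus>\<^bsub>left_quotient R I\<^esub>k\<in>A. I +> f k) = I +> (\<Oplus>k\<in>A. f k)"
  using assms
proof (induction A rule: finite_induct)
  interpret Q: abelian_monoid "left_quotient R I" by (rule abelian_monoid_left_quotient)
  case empty
  show ?case using a_coset_add_zero[OF a_subset] Q.finsum_empty by (simp add: left_quotient_def)
next
  interpret Q: abelian_monoid "left_quotient R I" by (rule abelian_monoid_left_quotient)
  case (insert x A)
  have "I +> f k \<in> carrier (left_quotient R I)" if "k \<in> insert x A" for k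
    using insert.prems that by (auto simp: left_quotient_def intro!: a_rcosetsI a_subset)
  then show ?case
    using insert by (simp add: Q.finsum_insert left_quotient_add)
qed

end

section \<open>The column module D^n and its projection onto (D/P)^n\<close>

definition regular_module :: "('d, 'r) ring_scheme \<Rightarrow> ('d, 'd) module"
  where "regular_module D =
    \<lparr>carrier = carrier D, mult = undefined, one = undefined, zero = \<zero>\<^bsub>D\<^esub>,
     add = add D, smult = mult D\<rparr>"

definition coset_column :: "nat \<Rightarrow> ('d, 'r) ring_scheme \<Rightarrow> 'd set \<Rightarrow> (nat \<Rightarrow> 'd) \<Rightarrow> nat \<Rightarrow> 'd set"
  where "coset_column n D P v = (\<lambda>i\<in>{..<n}. P +>\<^bsub>D\<^esub> v i)"

text \<open>\<open>finsum\<close> depends only on carrier, zero and addition, which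
  \<open>regular_module\<close> shares with \<open>D\<close>; unfolding it turns sums in the module
  into sums in the ring.\<close>

lemma regular_column_simps:
  "carrier (column_module n (regular_module D)) = {..<n} \<rightarrow>\<^sub>E carrier D"
  "v \<oplus>\<^bsub>column_module n (regular_module D)\<^esub> w = (\<lambda>i\<in>{..<n}. v i \<oplus>\<^bsub>D\<^esub> w i)"
  "A \<odot>\<^bsub>column_module n (regular_module D)\<^esub> v = (\<lambda>i\<in>{..<n}. \<Oplus>\<^bsub>D\<^esub>k\<in>{..<n}. A i k \<otimes>\<^bsub>D\<^esub> v k)"
  by (simp_all add: column_module_def regular_module_def finsum_def finprod_def)

lemma matrix_ring_simps:
  "carrier (matrix_ring n D) = {..<n} \<rightarrow>\<^sub>E ({..<n} \<rightarrow>\<^sub>E carrier D)"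
  "A \<otimes>\<^bsub>matrix_ring n D\<^esub> B = (\<lambda>i\<in>{..<n}. \<lambda>j\<in>{..<n}. \<Oplus>\<^bsub>D\<^esub>k\<in>{..<n}. A i k \<otimes>\<^bsub>D\<^esub> B k j)"
  "A \<oplus>\<^bsub>matrix_ring n D\<^esub> B = (\<lambda>i\<in>{..<n}. \<lambda>j\<in>{..<n}. A i j \<oplus>\<^bsub>D\<^esub> B i j)"
  "\<one>\<^bsub>matrix_ring n D\<^esub> = (\<lambda>i\<in>{..<n}. \<lambda>j\<in>{..<n}. if i = j then \<one>\<^bsub>D\<^esub> else \<zero>\<^bsub>D\<^esub>)"
  "\<zero>\<^bsub>matrix_ring n D\<^esub> = (\<lambda>i\<in>{..<n}. \<lambda>j\<in>{..<n}. \<zero>\<^bsub>D\<^esub>)"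
  by (simp_all add: matrix_ring_def)

context ring
begin

lemma regular_column_closed:
  assumes "v \<in> {..<n} \<rightarrow>\<^sub>E carrier R"
  shows "w \<in> {..<n} \<rightarrow>\<^sub>E carrier R \<Longrightarrow> v \<oplus>\<^bsub>column_module n (regular_module R)\<^esub> w \<in> {..<n} \<rightarrow>\<^sub>E carrier R"
    and "A \<in> carrier (matrix_ring n R) \<Longrightarrow> A \<odot>\<^bsub>column_module n (regular_module R)\<^esub> v \<in> {..<n} \<rightarrow>\<^sub>E carrier R"
proof -
  show "v \<oplus>\<^bsub>column_module n (regular_module R)\<^esub> w \<in> {..<n} \<rightarrow>\<^sub>E carrier R"
    if "w \<in> {..<n} \<rightarrow>\<^sub>E carrier R" for w
    unfolding regular_column_simps using assms that by auto
  show "A \<odot>\<^bsub>column_module n (regular_module R)\<^esub> v \<in> {..<n} \<rightarrow>\<^sub>E carrier R"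
    if A: "A \<in> carrier (matrix_ring n R)" for A
  proof -
    have "A i k \<otimes> v k \<in> carrier R" if "i < n" "k < n" for i k
      using assms A that by (intro m_closed) (auto simp: matrix_ring_simps PiE_iff)
    then show ?thesis unfolding regular_column_simps by (simp add: Pi_iff)
  qed
qed

end

text \<open>Each entry of the action is a finite sum of scalar multiples, and the coset map commutes
  with both operations.\<close>

lemma (in left_ideal) coset_column_hom:
  "coset_column n R I \<in>
    module_hom (matrix_ring n R) (column_module n (regular_module R)) (column_module n (left_quotient R I))"
  unfolding module_hom_def
proof (intro CollectI conjI ballI funcsetI)
  fix v assume "v \<in> carrier (column_module n (regular_module R))"
  then have v: "v \<in> {..<n} \<rightarrow>\<^sub>E carrier R" by (simp add: regular_column_simps)
  show "coset_column n R I v \<in> carrier (column_module n (left_quotient R I))"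
    using v by (auto simp: coset_column_def column_module_def left_quotient_def PiE_iff intro!: a_rcosetsI a_subset)
  fix A assume A: "A \<in> carrier (matrix_ring n R)"
  have Aik: "A i k \<in> carrier R" if "i < n" "k < n" for i k
    using A that by (auto simp: matrix_ring_simps PiE_iff)
  have vk: "v k \<in> carrier R" if "k < n" for k using v that by auto
  interpret Q: abelian_monoid "left_quotient R I" by (rule abelian_monoid_left_quotient)
  have "I +> (\<Oplus>k\<in>{..<n}. A i k \<otimes> v k)
    = (\<Oplus>\<^bsub>left_quotient R I\<^esub>k\<in>{..<n}. A i k \<odot>\<^bsub>left_quotient R I\<^esub> (I +> v k))" if "i < n" for i
  proof -
    have "I +> (\<Oplus>k\<in>{..<n}. A i k \<otimes> v k) = (\<Oplus>\<^bsub>left_quotient R I\<^esub>k\<in>{..<n}. I +> (A i k \<otimes> v k))"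
      using Aik[OF that] vk by (subst left_quotient_finsum) auto
    also have "\<dots> = (\<Oplus>\<^bsub>left_quotient R I\<^esub>k\<in>{..<n}. A i k \<odot>\<^bsub>left_quotient R I\<^esub> (I +> v k))"
      using Aik[OF that] vk
      by (intro Q.finsum_cong') (auto simp: left_quotient_smult, auto simp: left_quotient_def intro!: a_rcosetsI a_subset)
    finally show ?thesis .
  qed
  moreover have "(\<Oplus>\<^bsub>left_quotient R I\<^esub>k\<in>{..<n}. A i k \<odot>\<^bsub>left_quotient R I\<^esub> coset_column n R I v k)
    = (\<Oplus>\<^bsub>left_quotient R I\<^esub>k\<in>{..<n}. A i k \<odot>\<^bsub>left_quotient R I\<^esub> (I +> v k))" if "i < n" for i
    using Aik[OF that] vk
    by (intro Q.finsum_cong') (auto simp: coset_column_def left_quotient_smult, auto simp: left_quotient_def intro!: a_rcosetsI a_subset)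
  ultimately show "coset_column n R I (A \<odot>\<^bsub>column_module n (regular_module R)\<^esub> v)
    = A \<odot>\<^bsub>column_module n (left_quotient R I)\<^esub> coset_column n R I v"
    unfolding regular_column_simps
    by (auto simp: column_module_def coset_column_def cong: restrict_cong)
next
  fix v w assume "v \<in> carrier (column_module n (regular_module R))"
    "w \<in> carrier (column_module n (regular_module R))"
  then show "coset_column n R I (v \<oplus>\<^bsub>column_module n (regular_module R)\<^esub> w)
    = coset_column n R I v \<oplus>\<^bsub>column_module n (left_quotient R I)\<^esub> coset_column n R I w"
    unfolding regular_column_simps
    by (auto simp: column_module_def coset_column_def left_quotient_add PiE_iff
        cong: restrict_cong)
qed

lemma (in left_ideal) coset_column_surj:
  "coset_column n R I ` ({..<n} \<rightarrow>\<^sub>E carrier R) = carrier (column_module n (left_quotient R I))"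
proof
  show "coset_column n R I ` ({..<n} \<rightarrow>\<^sub>E carrier R) \<subseteq> carrier (column_module n (left_quotient R I))"
    using module_homD(1)[OF coset_column_hom] by (auto simp: regular_column_simps)
  show "carrier (column_module n (left_quotient R I)) \<subseteq> coset_column n R I ` ({..<n} \<rightarrow>\<^sub>E carrier R)"
  proof
    fix c assume c: "c \<in> carrier (column_module n (left_quotient R I))"
    then have "\<forall>i<n. \<exists>a\<in>carrier R. c i = I +> a"
      by (auto simp: column_module_def left_quotient_def A_RCOSETS_def' PiE_iff)
    then obtain v where v: "\<forall>i<n. v i \<in> carrier R \<and> c i = I +> v i" by metis
    \<comment> \<open>Representatives are chosen for indices below \<open>n\<close> only; the
      restriction makes the function extensional.\<close>
    then have "c = coset_column n R I (restrict v {..<n})"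
      using c by (auto simp: coset_column_def column_module_def PiE_iff extensional_def fun_eq_iff)
    then show "c \<in> coset_column n R I ` ({..<n} \<rightarrow>\<^sub>E carrier R)" using v by auto
  qed
qed

section \<open>Matrix units\<close>

text \<open>The matrix usually written a e_ij. An index outside the range gives the zero matrix, so
  \<open>matrix_unit_closed\<close> carries no bounds.\<close>

definition matrix_unit :: "nat \<Rightarrow> ('d, 'r) ring_scheme \<Rightarrow> nat \<Rightarrow> nat \<Rightarrow> 'd \<Rightarrow> nat \<Rightarrow> nat \<Rightarrow> 'd"
  where "matrix_unit n D i j a = (\<lambda>k\<in>{..<n}. \<lambda>l\<in>{..<n}. if k = i \<and> l = j then a else \<zero>\<^bsub>D\<^esub>)"

text \<open>Embeds D^n as the left ideal E e of matrices supported in column 0, where E is the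
  matrix ring and e its corner idempotent.\<close>

definition first_column :: "nat \<Rightarrow> ('d, 'r) ring_scheme \<Rightarrow> (nat \<Rightarrow> 'd) \<Rightarrow> nat \<Rightarrow> nat \<Rightarrow> 'd"
  where "first_column n D v = (\<lambda>k\<in>{..<n}. \<lambda>l\<in>{..<n}. if l = 0 then v k else \<zero>\<^bsub>D\<^esub>)"

text \<open>Under the embedding above these vectors become the corner e E e, a copy of
  \<open>D\<close>; see \<open>first_column_head\<close>.\<close>

definition head_vector :: "nat \<Rightarrow> ('d, 'r) ring_scheme \<Rightarrow> 'd \<Rightarrow> nat \<Rightarrow> 'd"
  where "head_vector n D a = (\<lambda>k\<in>{..<n}. if k = 0 then a else \<zero>\<^bsub>D\<^esub>)"

context ring
begin

lemma finsum_delta: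
  assumes "finite A" "i \<in> A" "a \<in> carrier R"
  shows "(\<Oplus>k\<in>A. if k = i then a else \<zero>) = a"
proof -
  have "(\<Oplus>k\<in>A. if k = i then a else \<zero>) = (\<Oplus>k\<in>A. if i = k then a else \<zero>)"
    using assms by (intro finsum_cong') auto
  then show ?thesis using finsum_singleton[of i A "\<lambda>_. a"] assms by simp
qed

lemma matrix_unit_closed [simp]:
  "a \<in> carrier R \<Longrightarrow> matrix_unit n R i j a \<in> carrier (matrix_ring n R)"
  by (auto simp: matrix_unit_def matrix_ring_simps)

lemma first_column_closed [simp]:
  "v \<in> {..<n} \<rightarrow>\<^sub>E carrier R \<Longrightarrow> first_column n R v \<in> carrier (matrix_ring n R)"
  by (simp add: first_column_def matrix_ring_simps PiE_iff)

lemma head_vector_closed [simp]: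
  "a \<in> carrier R \<Longrightarrow> head_vector n R a \<in> {..<n} \<rightarrow>\<^sub>E carrier R"
  by (auto simp: head_vector_def)

lemma first_column_head: "first_column n R (head_vector n R a) = matrix_unit n R 0 0 a"
  by (auto simp: first_column_def head_vector_def matrix_unit_def fun_eq_iff restrict_def)

lemma matrix_unit_smult:
  assumes "i < n" "j < n" "a \<in> carrier R" "v \<in> {..<n} \<rightarrow>\<^sub>E carrier R"
  shows "matrix_unit n R i j a \<odot>\<^bsub>column_module n (regular_module R)\<^esub> v
    = (\<lambda>k\<in>{..<n}. if k = i then a \<otimes> v j else \<zero>)"
proof -
  have vl: "v l \<in> carrier R" if "l < n" for l using assms(4) that by auto
  have "(\<Oplus>l\<in>{..<n}. matrix_unit n R i j a k l \<otimes> v l) = (if k = i then a \<otimes> v j else \<zero>)"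
    if "k < n" for k
  proof -
    have "(\<Oplus>l\<in>{..<n}. matrix_unit n R i j a k l \<otimes> v l)
      = (\<Oplus>l\<in>{..<n}. if l = j then (if k = i then a \<otimes> v j else \<zero>) else \<zero>)"
      using that assms(1-3) vl by (intro finsum_cong') (auto simp: matrix_unit_def)
    then show ?thesis using assms(1-3) vl by (simp add: finsum_delta)
  qed
  then show ?thesis unfolding regular_column_simps by (intro restrict_ext) simp
qed

text \<open>Moving entry \<open>i\<close> to the head reduces statements about columns to statements
  about single elements of the ring.\<close>

lemma matrix_unit_smult_head:
  assumes "i < n" "0 < n" "a \<in> carrier R" "v \<in> {..<n} \<rightarrow>\<^sub>E carrier R"
  shows "matrix_unit n R 0 i a \<odot>\<^bsub>column_module n (regular_module R)\<^esub> v = head_vector n R (a \<otimes> v i)"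
  using matrix_unit_smult[of 0 n i a v] assms by (simp add: head_vector_def)

lemma matrix_unit_mult:
  assumes "j < n" "a \<in> carrier R" "b \<in> carrier R"
  shows "matrix_unit n R i j a \<otimes>\<^bsub>matrix_ring n R\<^esub> matrix_unit n R j l b = matrix_unit n R i l (a \<otimes> b)"
proof -
  have "(\<Oplus>k\<in>{..<n}. matrix_unit n R i j a p k \<otimes> matrix_unit n R j l b k q)
      = (if p = i \<and> q = l then a \<otimes> b else \<zero>)" if "p < n" "q < n" for p q
  proof -
    have "(\<Oplus>k\<in>{..<n}. matrix_unit n R i j a p k \<otimes> matrix_unit n R j l b k q)
      = (\<Oplus>k\<in>{..<n}. if k = j then (if p = i \<and> q = l then a \<otimes> b else \<zero>) else \<zero>)"
      using that assms by (intro finsum_cong') (auto simp: matrix_unit_def)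
    then show ?thesis using assms by (simp add: finsum_delta)
  qed
  then show ?thesis
    unfolding matrix_ring_simps by (subst (3) matrix_unit_def) (intro restrict_ext, simp)
qed

lemma matrix_unit_add:
  assumes "a \<in> carrier R" "b \<in> carrier R"
  shows "matrix_unit n R i j (a \<oplus> b) = matrix_unit n R i j a \<oplus>\<^bsub>matrix_ring n R\<^esub> matrix_unit n R i j b"
  unfolding matrix_ring_simps using assms by (auto simp: matrix_unit_def fun_eq_iff restrict_def)

lemma first_column_add:
  assumes "v \<in> {..<n} \<rightarrow>\<^sub>E carrier R" "w \<in> {..<n} \<rightarrow>\<^sub>E carrier R"
  shows "first_column n R (v \<oplus>\<^bsub>column_module n (regular_module R)\<^esub> w)
    = first_column n R v \<oplus>\<^bsub>matrix_ring n R\<^esub> first_column n R w"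
  unfolding matrix_ring_simps regular_column_simps
  using assms unfolding first_column_def PiE_iff by (intro restrict_ext) simp

text \<open>Each column of a product is the matrix applied to that column of the second factor. With
  \<open>first_column_add\<close> this makes \<open>first_column\<close> a homomorphism of left
  modules over the matrix ring.\<close>

lemma mult_first_column:
  assumes "A \<in> carrier (matrix_ring n R)" "v \<in> {..<n} \<rightarrow>\<^sub>E carrier R"
  shows "A \<otimes>\<^bsub>matrix_ring n R\<^esub> first_column n R v
    = first_column n R (A \<odot>\<^bsub>column_module n (regular_module R)\<^esub> v)"
proof -
  have A: "A i k \<in> carrier R" if "i < n" "k < n" for i k
    using assms(1) that by (auto simp: matrix_ring_simps PiE_iff)
  have v: "v k \<in> carrier R" if "k < n" for k using assms(2) that by auto
  have "(\<Oplus>k\<in>{..<n}. A i k \<otimes> first_column n R v k j)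
    = (if j = 0 then \<Oplus>k\<in>{..<n}. A i k \<otimes> v k else \<zero>)" if "i < n" "j < n" for i j
  proof (cases "j = 0")
    case True
    then show ?thesis
      using that A v by (auto simp: first_column_def intro!: finsum_cong')
  next
    case False
    then have "(\<Oplus>k\<in>{..<n}. A i k \<otimes> first_column n R v k j) = (\<Oplus>k\<in>{..<n}. \<zero>)"
      using that A by (intro finsum_cong') (auto simp: first_column_def)
    then show ?thesis using False by simp
  qed
  then show ?thesis
    unfolding matrix_ring_simps regular_column_simps
    by (subst (2) first_column_def) (intro restrict_ext, simp)
qed

end

text \<open>Only the summand k = 0 survives. In this way the head vector of \<open>c\<close>
  generates every column with entries in R c.\<close>

lemma (in ring) first_column_smult_head:
  assumes "0 < n" "b \<in> {..<n} \<rightarrow>\<^sub>E carrier R" "c \<in> carrier R"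
  shows "first_column n R b \<odot>\<^bsub>column_module n (regular_module R)\<^esub> head_vector n R c = (\<lambda>i\<in>{..<n}. b i \<otimes> c)"
proof -
  have "(\<Oplus>k\<in>{..<n}. first_column n R b i k \<otimes> head_vector n R c k) = b i \<otimes> c" if "i < n" for i
  proof -
    have bi: "b i \<in> carrier R" using assms(2) that by auto
    have "(\<Oplus>k\<in>{..<n}. first_column n R b i k \<otimes> head_vector n R c k)
      = (\<Oplus>k\<in>{..<n}. if k = 0 then b i \<otimes> c else \<zero>)"
      using that assms(3) bi by (intro finsum_cong') (auto simp: first_column_def head_vector_def)
    then show ?thesis using assms bi by (simp add: finsum_delta)
  qed
  then show ?thesis unfolding regular_column_simps by (intro restrict_ext) simp
qed

lemma (in ring) head_vector_add:
  assumes "a \<in> carrier R" "b \<in> carrier R"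
  shows "head_vector n R a \<oplus>\<^bsub>column_module n (regular_module R)\<^esub> head_vector n R b = head_vector n R (a \<oplus> b)"
  unfolding regular_column_simps using assms by (auto simp: head_vector_def fun_eq_iff restrict_def)

lemma (in left_ideal) coset_column_head_eq_iff:
  assumes "0 < n" "a \<in> carrier R" "b \<in> carrier R"
  shows "coset_column n R I (head_vector n R a) = coset_column n R I (head_vector n R b) \<longleftrightarrow> a \<ominus> b \<in> I"
proof -
  have "coset_column n R I (head_vector n R a) = coset_column n R I (head_vector n R b) \<longleftrightarrow> I +> a = I +> b"
    using assms(1) by (auto simp: coset_column_def head_vector_def fun_eq_iff restrict_def)
  then show ?thesis using coset_eq_iff assms(2,3) by simp
qed

section \<open>Modules over a matrix ring\<close>

text \<open>Here \<open>M\<close> is a module over the matrix ring itself; the ring \<open>R\<close>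
  of the theorem enters only at the end. Positivity of \<open>n\<close> provides the corner index
  0.\<close>

locale matrix_module = D?: ring D + E: left_module "matrix_ring n D" M
  for D (structure) and n and M :: "(nat \<Rightarrow> nat \<Rightarrow> 'd, 'm, 'z) module_scheme" +
  assumes n_pos: "0 < n"
begin

abbreviation E where "E \<equiv> matrix_ring n D"
abbreviation DM where "DM \<equiv> column_module n (regular_module D)"
abbreviation unit where "unit \<equiv> matrix_unit n D"
abbreviation head where "head \<equiv> head_vector n D"
abbreviation col where "col \<equiv> first_column n D"

text \<open>The identity matrix is the sum of the e_kk = e_k0 e_0k, so an element is recovered from
  its components e_0k x.\<close>

lemma eq_if_first_components_eq:
  assumes x: "x \<in> carrier M" and y: "y \<in> carrier M"
    and eq: "\<And>i. i < n \<Longrightarrow> unit 0 i \<one> \<odot>\<^bsub>M\<^esub> x = unit 0 i \<one> \<odot>\<^bsub>M\<^esub> y"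
  shows "x = y"
proof -
  \<comment> \<open>\<open>d k\<close> is the partial sum of the first \<open>k\<close> diagonal
    units, running from the zero matrix to the identity.\<close>
  define d where "d k = (\<lambda>i\<in>{..<n}. \<lambda>j\<in>{..<n}. if i = j \<and> i < k then \<one> else \<zero>)" for k :: nat
  have dc: "d k \<in> carrier E" for k by (auto simp: d_def matrix_ring_simps)
  have "d k \<odot>\<^bsub>M\<^esub> x = d k \<odot>\<^bsub>M\<^esub> y" if "k \<le> n" for k
    using that
  proof (induction k)
    case 0
    have "d 0 = \<zero>\<^bsub>E\<^esub>" unfolding matrix_ring_simps by (simp add: d_def)
    then show ?case using x y by simp
  next
    case (Suc k)
    have "d (Suc k) = d k \<oplus>\<^bsub>E\<^esub> unit k k \<one>"
      unfolding matrix_ring_simps by (auto simp: d_def matrix_unit_def fun_eq_iff restrict_def)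
    moreover have "unit k k \<one> = unit k 0 \<one> \<otimes>\<^bsub>E\<^esub> unit 0 k \<one>"
      using matrix_unit_mult[of 0 n \<one> \<one> k k] n_pos by simp
    ultimately show ?case
      using Suc eq[of k] x y dc by (simp add: E.smult_l_distr E.smult_assoc1)
  qed
  moreover have "d n = \<one>\<^bsub>E\<^esub>"
    unfolding matrix_ring_simps by (auto simp: d_def fun_eq_iff restrict_def)
  ultimately show ?thesis using x y by (metis E.smult_one order_refl)
qed

lemma column_map_hom:
  assumes "m \<in> carrier M"
  shows "(\<lambda>v. col v \<odot>\<^bsub>M\<^esub> m) \<in> module_hom E DM (M\<lparr>carrier := {A \<odot>\<^bsub>M\<^esub> m | A. A \<in> carrier E}\<rparr>)"
  unfolding module_hom_def
proof (intro CollectI conjI ballI funcsetI)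
  fix v assume "v \<in> carrier DM"
  then have v: "v \<in> {..<n} \<rightarrow>\<^sub>E carrier D" by (simp add: regular_column_simps(1))
  then show "col v \<odot>\<^bsub>M\<^esub> m \<in> carrier (M\<lparr>carrier := {A \<odot>\<^bsub>M\<^esub> m | A. A \<in> carrier E}\<rparr>)"
    using first_column_closed by auto
  fix A assume "A \<in> carrier E"
  then show "col (A \<odot>\<^bsub>DM\<^esub> v) \<odot>\<^bsub>M\<^esub> m
    = A \<odot>\<^bsub>M\<lparr>carrier := {A \<odot>\<^bsub>M\<^esub> m | A. A \<in> carrier E}\<rparr>\<^esub> (col v \<odot>\<^bsub>M\<^esub> m)"
    using v assms by (simp add: mult_first_column[symmetric] E.smult_assoc1)
next
  fix v w assume "v \<in> carrier DM" "w \<in> carrier DM"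
  then show "col (v \<oplus>\<^bsub>DM\<^esub> w) \<odot>\<^bsub>M\<^esub> m
    = col v \<odot>\<^bsub>M\<^esub> m \<oplus>\<^bsub>M\<lparr>carrier := {A \<odot>\<^bsub>M\<^esub> m | A. A \<in> carrier E}\<rparr>\<^esub> col w \<odot>\<^bsub>M\<^esub> m"
    using assms by (simp add: first_column_add E.smult_l_distr regular_column_simps(1))
qed

text \<open>The annihilator of \<open>m\<close> for the action of \<open>D\<close> through the
  corner, where \<open>a\<close> acts as a e_00.\<close>

definition ann where "ann m = {a \<in> carrier D. unit 0 0 a \<odot>\<^bsub>M\<^esub> m = \<zero>\<^bsub>M\<^esub>}"

lemma ann_iff: "a \<in> carrier D \<Longrightarrow> a \<in> ann m \<longleftrightarrow> unit 0 0 a \<odot>\<^bsub>M\<^esub> m = \<zero>\<^bsub>M\<^esub>"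
  by (simp add: ann_def)

lemma unit_mult_smult:
  assumes "m \<in> carrier M" "a \<in> carrier D" "b \<in> carrier D"
  shows "unit 0 0 a \<odot>\<^bsub>M\<^esub> (unit 0 0 b \<odot>\<^bsub>M\<^esub> m) = unit 0 0 (a \<otimes> b) \<odot>\<^bsub>M\<^esub> m"
  using assms n_pos by (simp add: matrix_unit_mult flip: E.smult_assoc1)

lemma left_ideal_ann:
  assumes m: "m \<in> carrier M"
  shows "left_ideal (ann m) D"
proof (rule left_idealI)
  have "unit 0 0 \<zero> = \<zero>\<^bsub>E\<^esub>"
    unfolding matrix_ring_simps by (auto simp: matrix_unit_def fun_eq_iff restrict_def)
  then show "\<zero> \<in> ann m" using m by (simp add: ann_def)
  show "ann m \<subseteq> carrier D" by (auto simp: ann_def)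
  show "x \<oplus> y \<in> ann m" if "x \<in> ann m" "y \<in> ann m" for x y
    using that m by (simp add: ann_def matrix_unit_add E.smult_l_distr)
  show "a \<otimes> x \<in> ann m" if "a \<in> carrier D" "x \<in> ann m" for a x
    using that unit_mult_smult[OF m, of a x] by (simp add: ann_def)
qed

text \<open>The condition on \<open>m\<close> says that \<open>m\<close> is fixed by the idempotent with corner entry \<open>1\<close>.
  The map \<open>v \<mapsto> col v m\<close> from \<open>D\<^sup>n\<close> onto \<open>E m\<close> then has kernel \<open>(ann m)\<^sup>n\<close>.\<close>

lemma cyclic_iso_column:
  assumes m: "m \<in> carrier M" "unit 0 0 \<one> \<odot>\<^bsub>M\<^esub> m = m"
  shows "isomorphic_modules E (M\<lparr>carrier := {A \<odot>\<^bsub>M\<^esub> m | A. A \<in> carrier E}\<rparr>)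
    (column_module n (left_quotient D (ann m)))"
proof -
  interpret J: left_ideal "ann m" D using left_ideal_ann[OF m(1)] .
  have unit_eq: "unit 0 0 a \<odot>\<^bsub>M\<^esub> m = unit 0 0 b \<odot>\<^bsub>M\<^esub> m \<longleftrightarrow> ann m +> a = ann m +> b"
    if "a \<in> carrier D" "b \<in> carrier D" for a b
  proof -
    have "unit 0 0 a = unit 0 0 (a \<ominus> b) \<oplus>\<^bsub>E\<^esub> unit 0 0 b"
      using that matrix_unit_add[of "a \<ominus> b" b n 0 0] by (simp add: minus_eq a_assoc l_neg)
    then have "unit 0 0 a \<odot>\<^bsub>M\<^esub> m = unit 0 0 (a \<ominus> b) \<odot>\<^bsub>M\<^esub> m \<oplus>\<^bsub>M\<^esub> unit 0 0 b \<odot>\<^bsub>M\<^esub> m"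
      using that m(1) by (simp add: E.smult_l_distr)
    then have "unit 0 0 a \<odot>\<^bsub>M\<^esub> m = unit 0 0 b \<odot>\<^bsub>M\<^esub> m \<longleftrightarrow> unit 0 0 (a \<ominus> b) \<odot>\<^bsub>M\<^esub> m = \<zero>\<^bsub>M\<^esub>"
      using that m(1) by (simp add: E.M.add.r_cancel_one)
    moreover have "a \<ominus> b \<in> ann m \<longleftrightarrow> unit 0 0 (a \<ominus> b) \<odot>\<^bsub>M\<^esub> m = \<zero>\<^bsub>M\<^esub>"
      using D.minus_closed[OF that] unfolding ann_def by blast
    ultimately show ?thesis unfolding J.coset_eq_iff[OF that] by (rule trans[OF _ sym])
  qed
  \<comment> \<open>e_0i times \<open>col v\<close> is the matrix whose only entry is
    \<open>v i\<close> in the corner.\<close>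
  have comp: "unit 0 i \<one> \<odot>\<^bsub>M\<^esub> (col v \<odot>\<^bsub>M\<^esub> m) = unit 0 0 (v i) \<odot>\<^bsub>M\<^esub> m"
    if "v \<in> {..<n} \<rightarrow>\<^sub>E carrier D" "i < n" for v i
  proof -
    have "v i \<in> carrier D" using that by auto
    then show ?thesis
      using that m(1) n_pos mult_first_column[of "unit 0 i \<one>" n v] matrix_unit_smult_head[of i n \<one> v]
      by (simp add: E.smult_assoc1[symmetric] first_column_head)
  qed
  show ?thesis
  proof (rule isomorphic_modules_if_same_kernel[OF column_map_hom[OF m(1)] _ J.coset_column_hom])
    show "(\<lambda>v. col v \<odot>\<^bsub>M\<^esub> m) ` carrier DM = carrier (M\<lparr>carrier := {A \<odot>\<^bsub>M\<^esub> m | A. A \<in> carrier E}\<rparr>)"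
    proof
      show "(\<lambda>v. col v \<odot>\<^bsub>M\<^esub> m) ` carrier DM \<subseteq> carrier (M\<lparr>carrier := {A \<odot>\<^bsub>M\<^esub> m | A. A \<in> carrier E}\<rparr>)"
        using first_column_closed by (auto simp: regular_column_simps(1))
      \<comment> \<open>Since m = e m, only A e matters. It is \<open>col\<close> of the first
        column of \<open>A\<close>, and that column is \<open>A\<close> applied to
        \<open>head \<one>\<close>.\<close>
      have "A \<odot>\<^bsub>M\<^esub> m \<in> (\<lambda>v. col v \<odot>\<^bsub>M\<^esub> m) ` carrier DM" if A: "A \<in> carrier E" for A
      proof -
        have h: "head \<one> \<in> {..<n} \<rightarrow>\<^sub>E carrier D" by simp
        have "A \<odot>\<^bsub>M\<^esub> m = A \<odot>\<^bsub>M\<^esub> (unit 0 0 \<one> \<odot>\<^bsub>M\<^esub> m)" using m by simp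
        also have "\<dots> = col (A \<odot>\<^bsub>DM\<^esub> head \<one>) \<odot>\<^bsub>M\<^esub> m"
          using A m(1) mult_first_column[OF A h]
          by (simp add: E.smult_assoc1[symmetric] first_column_head)
        finally show ?thesis
          using regular_column_closed(2)[OF h A] by (auto simp: regular_column_simps(1))
      qed
      then show "carrier (M\<lparr>carrier := {A \<odot>\<^bsub>M\<^esub> m | A. A \<in> carrier E}\<rparr>) \<subseteq> (\<lambda>v. col v \<odot>\<^bsub>M\<^esub> m) ` carrier DM"
        by auto
    qed
    show "coset_column n D (ann m) ` carrier DM = carrier (column_module n (left_quotient D (ann m)))"
      using J.coset_column_surj by (simp add: regular_column_simps(1))
  next
    fix v w assume "v \<in> carrier DM" "w \<in> carrier DM"
    then have v: "v \<in> {..<n} \<rightarrow>\<^sub>E carrier D" and w: "w \<in> {..<n} \<rightarrow>\<^sub>E carrier D"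
      by (simp_all add: regular_column_simps(1))
    \<comment> \<open>Equality in \<open>M\<close> is tested on components, and each component is a
      corner multiple of \<open>m\<close>.\<close>
    have "col v \<odot>\<^bsub>M\<^esub> m = col w \<odot>\<^bsub>M\<^esub> m
      \<longleftrightarrow> (\<forall>i<n. unit 0 0 (v i) \<odot>\<^bsub>M\<^esub> m = unit 0 0 (w i) \<odot>\<^bsub>M\<^esub> m)"
      using eq_if_first_components_eq[of "col v \<odot>\<^bsub>M\<^esub> m" "col w \<odot>\<^bsub>M\<^esub> m"] v w m(1) comp by (metis E.smult_closed first_column_closed)
    also have "\<dots> \<longleftrightarrow> (\<forall>i<n. ann m +> v i = ann m +> w i)"
      using unit_eq v w by (metis PiE_mem lessThan_iff)
    also have "\<dots> \<longleftrightarrow> coset_column n D (ann m) v = coset_column n D (ann m) w"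
      by (auto simp: coset_column_def fun_eq_iff restrict_def)
    finally show "col v \<odot>\<^bsub>M\<^esub> m = col w \<odot>\<^bsub>M\<^esub> m
      \<longleftrightarrow> coset_column n D (ann m) v = coset_column n D (ann m) w" .
    show "v \<oplus>\<^bsub>DM\<^esub> w \<in> carrier DM"
      using regular_column_closed(1)[OF v w] by (simp add: regular_column_simps(1))
  next
    fix A v assume "A \<in> carrier E" "v \<in> carrier DM"
    then show "A \<odot>\<^bsub>DM\<^esub> v \<in> carrier DM"
      using regular_column_closed(2) by (simp add: regular_column_simps(1))
  qed
qed

section \<open>The two implications over the matrix ring\<close>

lemma exists_nonzero_corner_element:
  assumes "x \<in> carrier M" "x \<noteq> \<zero>\<^bsub>M\<^esub>"
  obtains i where "i < n" "unit 0 i \<one> \<odot>\<^bsub>M\<^esub> x \<noteq> \<zero>\<^bsub>M\<^esub>"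
proof -
  have "\<exists>i<n. unit 0 i \<one> \<odot>\<^bsub>M\<^esub> x \<noteq> \<zero>\<^bsub>M\<^esub>"
  proof (rule ccontr)
    assume "\<not> ?thesis"
    then have "x = \<zero>\<^bsub>M\<^esub>" using assms(1) eq_if_first_components_eq[of x "\<zero>\<^bsub>M\<^esub>"] by simp
    then show False using assms(2) by contradiction
  qed
  then show ?thesis using that by blast
qed

text \<open>By e_00 e_0i = e_0i, components of elements satisfy the hypothesis of
  \<open>cyclic_iso_column\<close>.\<close>

lemma corner_idem:
  assumes "x \<in> carrier M" "i < n"
  shows "unit 0 0 \<one> \<odot>\<^bsub>M\<^esub> (unit 0 i \<one> \<odot>\<^bsub>M\<^esub> x) = unit 0 i \<one> \<odot>\<^bsub>M\<^esub> x"
  using assms n_pos by (simp add: matrix_unit_mult flip: E.smult_assoc1)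

lemma virtually_simple_iso_column:
  assumes vs: "virtually_simple_module E M"
    and m: "m \<in> carrier M" "unit 0 0 \<one> \<odot>\<^bsub>M\<^esub> m = m" "m \<noteq> \<zero>\<^bsub>M\<^esub>"
  shows "isomorphic_modules E M (column_module n (left_quotient D (ann m)))"
  by (rule isomorphic_modules_trans[OF E.virtually_simple_iso_cyclic cyclic_iso_column]) fact+

lemma virtually_simple_imp_iso_column:
  assumes D: "principal_ideal_V_domain D" and vs: "virtually_simple_module E M"
  shows "\<exists>P. (maximal_left_ideal P D \<or> P = {\<zero>}) \<and>
    isomorphic_modules E M (column_module n (left_quotient D P))"
proof -
  interpret P: principal_ideal_V_domain D by fact
  obtain x where x: "x \<in> carrier M" "x \<noteq> \<zero>\<^bsub>M\<^esub>"
    using virtually_simple_module.nonzero[OF vs] E.M.zero_closed by blast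
  obtain i where i: "i < n" "unit 0 i \<one> \<odot>\<^bsub>M\<^esub> x \<noteq> \<zero>\<^bsub>M\<^esub>"
    using exists_nonzero_corner_element[OF x] .
  define m where "m = unit 0 i \<one> \<odot>\<^bsub>M\<^esub> x"
  have m: "m \<in> carrier M" "unit 0 0 \<one> \<odot>\<^bsub>M\<^esub> m = m" "m \<noteq> \<zero>\<^bsub>M\<^esub>"
    using x(1) i corner_idem[OF x(1) i(1)] unfolding m_def by simp_all
  interpret J: left_ideal "ann m" D using left_ideal_ann[OF m(1)] .
  obtain c where c: "c \<in> carrier D" and ann_m: "ann m = {b \<otimes> c | b. b \<in> carrier D}"
    using P.left_principal[OF J.left_ideal_axioms] by blast
  show ?thesis
  proof (cases "c = \<zero>")
    case True
    have "ann m \<subseteq> {\<zero>}" unfolding ann_m True by auto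
    then have "ann m = {\<zero>}" using J.zero_closed by blast
    then show ?thesis using virtually_simple_iso_column[OF vs m] by metis
  next
    case False
    \<comment> \<open>If \<open>\<one>\<close> annihilated \<open>m\<close>, then m = e m would
      vanish.\<close>
    have "\<one> \<notin> ann m" using m(2,3) ann_iff[OF D.one_closed] by simp
    then obtain a y where a: "a \<in> carrier D" and y: "y \<in> carrier D" and cay: "c = a \<otimes> y"
      and max: "maximal_left_ideal {b \<otimes> a | b. b \<in> carrier D} D" and y_ann: "y \<notin> ann m"
      using P.irreducible_left_factor[OF c False] unfolding ann_m by blast
    \<comment> \<open>Passing from \<open>m\<close> to y m replaces the annihilator D a y by D a: d
      y lies in D a y exactly when d lies in D a, after cancelling \<open>y\<close>.\<close>
    define m' where "m' = unit 0 0 y \<odot>\<^bsub>M\<^esub> m"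
    have m': "m' \<in> carrier M" "unit 0 0 \<one> \<odot>\<^bsub>M\<^esub> m' = m'" "m' \<noteq> \<zero>\<^bsub>M\<^esub>"
      using m(1) y y_ann unit_mult_smult[OF m(1) D.one_closed y] ann_iff[OF y, of m]
      by (simp_all add: m'_def)
    have y0: "y \<noteq> \<zero>" using y_ann J.zero_closed by blast
    have "d \<in> ann m' \<longleftrightarrow> d \<in> {b \<otimes> a | b. b \<in> carrier D}" if d: "d \<in> carrier D" for d
    proof -
      have "d \<in> ann m' \<longleftrightarrow> d \<otimes> y \<in> ann m"
        unfolding ann_iff[OF d] ann_iff[OF D.m_closed[OF d y]] m'_def unit_mult_smult[OF m(1) d y] ..
      also have "\<dots> \<longleftrightarrow> (\<exists>b\<in>carrier D. d \<otimes> y = (b \<otimes> a) \<otimes> y)"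
        unfolding ann_m cay using D.m_assoc[OF _ a y] by auto
      also have "\<dots> \<longleftrightarrow> (\<exists>b\<in>carrier D. d = b \<otimes> a)"
        using P.right_cancel[OF d _ y y0] a D.m_closed by blast
      finally show ?thesis by blast
    qed
    moreover have "ann m' \<subseteq> carrier D" "{b \<otimes> a | b. b \<in> carrier D} \<subseteq> carrier D"
      using a D.m_closed unfolding ann_def by blast+
    ultimately have "ann m' = {b \<otimes> a | b. b \<in> carrier D}" by blast
    then show ?thesis using virtually_simple_iso_column[OF vs m'] max by metis
  qed
qed

text \<open>The premise \<open>generator\<close> captures what maximal \<open>P\<close> and P = 0
  have in common. A nonzero submodule \<open>N\<close> is determined by the ideal \<open>I\<close>
  of its possible entries and turns out to be E m for one \<open>m\<close> with annihilator
  \<open>P\<close>, hence a copy of the column.\<close>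

lemma virtually_simple_if_iso_column:
  assumes P: "left_ideal P D" "P \<noteq> carrier D"
    and generator: "\<And>I. left_ideal I D \<Longrightarrow> P \<subset> I \<Longrightarrow>
      \<exists>c\<in>carrier D. I = {b \<otimes> c | b. b \<in> carrier D} \<and> {d \<in> carrier D. d \<otimes> c \<in> P} = P"
    and iso: "isomorphic_modules E M (column_module n (left_quotient D P))"
  shows "virtually_simple_module E M"
proof -
  interpret P: left_ideal P D by fact
  let ?C = "column_module n (left_quotient D P)" and ?q = "coset_column n D P"
  let ?V = "{..<n} \<rightarrow>\<^sub>E carrier D"
  obtain f where f: "f \<in> module_hom E M ?C" "bij_betw f (carrier M) (carrier ?C)"
    using iso unfolding isomorphic_modules_def by blast
  note q = module_homD[OF P.coset_column_hom[of n], unfolded regular_column_simps(1)]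
  have inj: "x = y" if "x \<in> carrier M" "y \<in> carrier M" "f x = f y" for x y
    using that f(2) by (auto simp: bij_betw_def inj_on_def)
  have lift: "\<exists>v\<in>?V. f x = ?q v" if "x \<in> carrier M" for x
    using module_homD(1)[OF f(1) that] P.coset_column_surj[of n] by blast
  have pre: "\<exists>x\<in>carrier M. f x = ?q v" if "v \<in> ?V" for v
    using q(1)[OF that] f(2) by (metis bij_betw_def imageE)
  have f_smult: "f (A \<odot>\<^bsub>M\<^esub> x) = ?q (A \<odot>\<^bsub>DM\<^esub> v)"
    if "A \<in> carrier E" "x \<in> carrier M" "v \<in> ?V" "f x = ?q v" for A x v
    using module_homD(3)[OF f(1) that(1,2)] q(3)[OF that(1,3)] that(4) by simp
  have f_unit: "f (unit 0 i a \<odot>\<^bsub>M\<^esub> x) = ?q (head (a \<otimes> v i))"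
    if "i < n" "a \<in> carrier D" "x \<in> carrier M" "v \<in> ?V" "f x = ?q v" for i a x v
    using f_smult[of "unit 0 i a" x v] matrix_unit_smult_head[of i n a v] n_pos that by simp
  have f_unit_head: "f (unit 0 0 a \<odot>\<^bsub>M\<^esub> x) = ?q (head (a \<otimes> b))"
    if "a \<in> carrier D" "x \<in> carrier M" "b \<in> carrier D" "f x = ?q (head b)" for a b x
    using f_unit[of 0 a x "head b"] that n_pos by (simp add: head_vector_def)
  \<comment> \<open>The column record has not been shown to be a group, so the image of zero is
    computed by letting the scalar 0 act in the corner.\<close>
  have f_zero: "f \<zero>\<^bsub>M\<^esub> = ?q (head \<zero>)"
  proof -
    obtain v where v: "v \<in> ?V" "f \<zero>\<^bsub>M\<^esub> = ?q v" using lift[OF E.M.zero_closed] by blast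
    then show ?thesis using f_unit[of 0 \<zero> "\<zero>\<^bsub>M\<^esub>" v] n_pos by (auto simp: PiE_iff)
  qed
  have zero_iff: "x = \<zero>\<^bsub>M\<^esub> \<longleftrightarrow> a \<in> P"
    if "x \<in> carrier M" "a \<in> carrier D" "f x = ?q (head a)" for x a
  proof -
    have "x = \<zero>\<^bsub>M\<^esub> \<longleftrightarrow> ?q (head a) = ?q (head \<zero>)"
      using inj[OF that(1) E.M.zero_closed] f_zero that(3) by auto
    then show ?thesis
      using P.coset_column_head_eq_iff[OF n_pos that(2) D.zero_closed] that(2) by (simp add: minus_eq)
  qed
  show ?thesis
  proof (rule virtually_simple_module.intro[OF E.left_module_axioms], rule virtually_simple_module_axioms.intro)
    obtain x where x: "x \<in> carrier M" "f x = ?q (head \<one>)" using pre[of "head \<one>"] by auto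
    then have "x \<noteq> \<zero>\<^bsub>M\<^esub>" using zero_iff[of x \<one>] P(2) P.proper_iff by simp
    then show "carrier M \<noteq> {\<zero>\<^bsub>M\<^esub>}" using x(1) by blast
  next
    fix N assume N: "submodule N E M" and N_ne: "N \<noteq> {\<zero>\<^bsub>M\<^esub>}"
    interpret N: submodule N E M by fact
    have NM: "x \<in> carrier M" if "x \<in> N" for x using that N.subset by auto
    have N0: "\<zero>\<^bsub>M\<^esub> \<in> N" using N.one_closed by simp
    \<comment> \<open>\<open>I\<close> collects the heads of vectors representing elements of
      \<open>N\<close>. Every entry of such an element occurs as a head, since e_0i moves it there
      without leaving \<open>N\<close>.\<close>
    define I where "I = {a \<in> carrier D. \<exists>x\<in>N. f x = ?q (head a)}"
    have component_mem: "v i \<in> I" if "x \<in> N" "v \<in> ?V" "f x = ?q v" "i < n" for x v i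
    proof -
      have "v i \<in> carrier D" using that by auto
      then have "f (unit 0 i \<one> \<odot>\<^bsub>M\<^esub> x) = ?q (head (v i))"
        using f_unit[of i \<one> x v] that NM by simp
      moreover have "unit 0 i \<one> \<odot>\<^bsub>M\<^esub> x \<in> N" using that by simp
      ultimately show ?thesis unfolding I_def using \<open>v i \<in> carrier D\<close> by blast
    qed
    have I_ideal: "left_ideal I D"
    proof (rule left_idealI)
      show "I \<subseteq> carrier D" by (auto simp: I_def)
      show "\<zero> \<in> I" using N0 f_zero by (auto simp: I_def)
      show "a \<oplus> b \<in> I" if aI: "a \<in> I" and bI: "b \<in> I" for a b
      proof -
        obtain x where x: "x \<in> N" "f x = ?q (head a)" using aI unfolding I_def by blast
        obtain y where y: "y \<in> N" "f y = ?q (head b)" using bI unfolding I_def by blast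
        have ab: "a \<in> carrier D" "b \<in> carrier D" using aI bI unfolding I_def by blast+
        have "f (x \<oplus>\<^bsub>M\<^esub> y) = ?q (head (a \<oplus> b))"
          using module_homD(2)[OF f(1) NM[OF x(1)] NM[OF y(1)]] x y ab
            q(2)[of "head a" "head b"] head_vector_add[of a b n] by simp
        moreover have "x \<oplus>\<^bsub>M\<^esub> y \<in> N" using N.m_closed x y by simp
        ultimately show ?thesis using ab unfolding I_def by blast
      qed
      show "b \<otimes> a \<in> I" if b: "b \<in> carrier D" and aI: "a \<in> I" for b a
      proof -
        obtain x where x: "x \<in> N" "f x = ?q (head a)" and a: "a \<in> carrier D"
          using aI unfolding I_def by blast
        have "unit 0 0 b \<odot>\<^bsub>M\<^esub> x \<in> N" using x(1) b by simp
        then show ?thesis using f_unit_head[OF b NM[OF x(1)] a x(2)] a b unfolding I_def by blast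
      qed
    qed
    have "P \<subset> I"
    proof
      show "P \<subseteq> I"
      proof
        fix p assume p: "p \<in> P"
        then have "?q (head p) = ?q (head \<zero>)"
          using P.coset_column_head_eq_iff[OF n_pos, of p \<zero>] P.a_subset by (auto simp: minus_eq)
        then show "p \<in> I" using N0 f_zero p P.a_subset by (auto simp: I_def)
      qed
      have "\<exists>y\<in>N. y \<noteq> \<zero>\<^bsub>M\<^esub>" using N_ne N0 by blast
      then obtain y where y: "y \<in> N" "y \<noteq> \<zero>\<^bsub>M\<^esub>" by blast
      obtain i where i: "i < n" "unit 0 i \<one> \<odot>\<^bsub>M\<^esub> y \<noteq> \<zero>\<^bsub>M\<^esub>"
        using exists_nonzero_corner_element[OF NM[OF y(1)] y(2)] .
      obtain v where v: "v \<in> ?V" "f y = ?q v" using lift[OF NM[OF y(1)]] by blast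
      have vi: "v i \<in> carrier D" using v(1) i(1) by auto
      \<comment> \<open>This entry represents a nonzero component, yet lies in \<open>I\<close>
        because \<open>y\<close> is in \<open>N\<close>; so the inclusion is strict.\<close>
      have "v i \<notin> P"
        using zero_iff[of "unit 0 i \<one> \<odot>\<^bsub>M\<^esub> y" "v i"] f_unit[of i \<one> y v] NM[OF y(1)] v i vi by simp
      then show "P \<noteq> I" using component_mem[OF y(1) v i(1)] by blast
    qed
    then obtain c where c: "c \<in> carrier D" and I_eq: "I = {b \<otimes> c | b. b \<in> carrier D}"
      and quot: "{d \<in> carrier D. d \<otimes> c \<in> P} = P" using generator[OF I_ideal] by blast
    have "c \<in> I" unfolding I_eq using D.one_closed D.l_one[OF c, symmetric] by blast
    then obtain m where m: "m \<in> N" "f m = ?q (head c)" by (auto simp: I_def)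
    have mM: "m \<in> carrier M" using NM m(1) .
    \<comment> \<open>The corner idempotent keeps the head \<open>c\<close>, and \<open>f\<close> is
      injective.\<close>
    have idem: "unit 0 0 \<one> \<odot>\<^bsub>M\<^esub> m = m"
      using f_unit_head[OF D.one_closed mM c m(2)] c m(2) mM by (intro inj) simp_all
    have "a \<in> ann m \<longleftrightarrow> a \<otimes> c \<in> P" if "a \<in> carrier D" for a
      using zero_iff[OF _ _ f_unit_head[OF that mM c m(2)]] that c mM by (simp add: ann_def)
    then have ann_m: "ann m = P" using quot by (auto simp: ann_def)
    have "N = {A \<odot>\<^bsub>M\<^esub> m | A. A \<in> carrier E}"
    proof
      show "{A \<odot>\<^bsub>M\<^esub> m | A. A \<in> carrier E} \<subseteq> N" using m(1) by auto
      show "N \<subseteq> {A \<odot>\<^bsub>M\<^esub> m | A. A \<in> carrier E}"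
      proof
        fix w assume w: "w \<in> N"
        obtain v where v: "v \<in> ?V" "f w = ?q v" using lift[OF NM[OF w]] by blast
        \<comment> \<open>All entries of \<open>v\<close> lie in I = D c; the matrix whose first
          column is made of the cofactors \<open>b i\<close> carries \<open>m\<close> to
          \<open>w\<close>.\<close>
        have "\<forall>i<n. \<exists>b\<in>carrier D. v i = b \<otimes> c"
          using component_mem[OF w v] unfolding I_eq by blast
        then obtain b where b: "\<And>i. i < n \<Longrightarrow> b i \<in> carrier D \<and> v i = b i \<otimes> c" by metis
        define b' where "b' = restrict b {..<n}"
        have b': "b' \<in> ?V" using b by (auto simp: b'_def)
        have "col b' \<odot>\<^bsub>DM\<^esub> head c = v"
          unfolding first_column_smult_head[OF n_pos b' c]
          using b v(1) by (auto simp: b'_def fun_eq_iff restrict_def PiE_iff extensional_def)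
        then have "f (col b' \<odot>\<^bsub>M\<^esub> m) = f w"
          using f_smult[OF first_column_closed[OF b'] mM head_vector_closed[OF c] m(2)] v(2) by simp
        then have "w = col b' \<odot>\<^bsub>M\<^esub> m"
          using inj[of w "col b' \<odot>\<^bsub>M\<^esub> m"] NM[OF w] mM first_column_closed[OF b'] by simp
        then show "w \<in> {A \<odot>\<^bsub>M\<^esub> m | A. A \<in> carrier E}" using first_column_closed[OF b'] by blast
      qed
    qed
    \<comment> \<open>N = E m is the column of D / ann m, which is D/P.\<close>
    then have "isomorphic_modules E (M\<lparr>carrier := N\<rparr>) ?C"
      using cyclic_iso_column[OF mM idem] ann_m by simp
    moreover have "isomorphic_modules E ?C M"
      using isomorphic_modules_sym[OF iso] by simp
    ultimately show "isomorphic_modules E (M\<lparr>carrier := N\<rparr>) M"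
      using isomorphic_modules_trans by blast
  qed
qed

end

section \<open>Transport along the isomorphism of R with the matrix ring\<close>

lemma ring_if_ring_iso_matrix_ring:
  assumes "ring R" "ring D" "\<phi> \<in> ring_iso R (matrix_ring n D)"
  shows "ring (matrix_ring n D)"
proof -
  interpret R: ring R by fact
  interpret D: ring D by fact
  let ?z = "\<phi> \<zero>\<^bsub>R\<^esub>"
  have hom: "\<phi> \<in> ring_hom R (matrix_ring n D)" using assms(3) by (simp add: ring_iso_def)
  have z: "?z \<in> carrier (matrix_ring n D)" using ring_hom_closed[OF hom] by simp
  \<comment> \<open>By definition a ring isomorphism respects sums, products and one. That it sends
    zero to the zero matrix follows entrywise from z + z = z in the additive group of
    \<open>D\<close>.\<close>
  have "?z \<oplus>\<^bsub>matrix_ring n D\<^esub> ?z = ?z" using ring_hom_add[OF hom R.zero_closed R.zero_closed] by simp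
  then have "?z i j \<oplus>\<^bsub>D\<^esub> ?z i j = ?z i j" if "i < n" "j < n" for i j
  proof -
    have "(?z \<oplus>\<^bsub>matrix_ring n D\<^esub> ?z) i j = ?z i j" using \<open>?z \<oplus>\<^bsub>matrix_ring n D\<^esub> ?z = ?z\<close> by simp
    then show ?thesis using that by (simp add: matrix_ring_simps)
  qed
  moreover have "?z i j \<in> carrier D" if "i < n" "j < n" for i j
    using z that by (auto simp: matrix_ring_simps PiE_iff)
  ultimately have "?z i j = \<zero>\<^bsub>D\<^esub>" if "i < n" "j < n" for i j
    using that D.add.l_cancel_one' by metis
  then have "?z = \<zero>\<^bsub>matrix_ring n D\<^esub>"
    using z by (auto simp: matrix_ring_simps fun_eq_iff restrict_def PiE_iff extensional_def)
  \<comment> \<open>The image of \<open>R\<close> is a ring with zero \<open>?z\<close>, which is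
    the zero already stored in the record.\<close>
  then show ?thesis using R.ring_iso_imp_img_ring[OF assms(3)] by simp
qed

theorem corollary3p3:
  fixes R :: "('r, 'x) ring_scheme"
    and D :: "('d, 'y) ring_scheme"
    and M :: "('r, 'm, 'z) module_scheme"
    and n :: nat
    and \<phi> :: "'r \<Rightarrow> nat \<Rightarrow> nat \<Rightarrow> 'd"
  assumes "ring R"
    and "n \<ge> 1"
    and "principal_ideal_V_domain D"
    and "\<phi> \<in> ring_iso R (matrix_ring n D)"
    and "left_module R M"
  shows "virtually_simple_module R M \<longleftrightarrow>
    (\<exists>P. (maximal_left_ideal P D \<or> P = {\<zero>\<^bsub>D\<^esub>}) \<and>
      isomorphic_modules R M
        (restrict_scalars \<phi> (column_module n (left_quotient D P))))"
proof -
  interpret D: principal_ideal_V_domain D by fact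
  interpret M: left_module R M by fact
  let ?E = "matrix_ring n D"
  interpret E: ring ?E using ring_if_ring_iso_matrix_ring[OF assms(1) D.ring_axioms assms(4)] .
  define \<psi> where "\<psi> = inv_into (carrier R) \<phi>"
  have bij: "bij_betw \<phi> (carrier R) (carrier ?E)" using assms(4) by (simp add: ring_iso_def)
  have "\<psi> \<in> ring_iso ?E R" unfolding \<psi>_def using ring_iso_set_sym[OF assms(1,4)] .
  then have \<psi>: "\<psi> \<in> ring_hom ?E R" "\<psi> ` carrier ?E = carrier R"
    by (auto simp: ring_iso_def bij_betw_def)
  have \<phi>\<psi>: "\<phi> (\<psi> A) = A" if "A \<in> carrier ?E" for A
    using that bij_betw_inv_into_right[OF bij] by (simp add: \<psi>_def)
  let ?M = "restrict_scalars \<psi> M"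
  interpret MM: matrix_module D n ?M
    using M.left_module_restrict_scalars[OF \<psi>(1) E.ring_axioms] assms(2)
    by (intro matrix_module.intro D.ring_axioms matrix_module_axioms.intro) simp_all
  \<comment> \<open>The two sets of homomorphisms coincide: every scalar of \<open>R\<close> is some
    \<open>\<psi> A\<close>, and \<open>\<phi>\<close> takes it back to \<open>A\<close>.\<close>
  have iso: "isomorphic_modules R M (restrict_scalars \<phi> C) \<longleftrightarrow> isomorphic_modules ?E ?M C"
    for C :: "(nat \<Rightarrow> nat \<Rightarrow> 'd, nat \<Rightarrow> 'd set) module"
  proof -
    have "module_hom R M (restrict_scalars \<phi> C) = module_hom ?E ?M C"
      unfolding module_hom_def \<psi>(2)[symmetric]
      by (auto simp: restrict_scalars_def \<phi>\<psi>)
    then show ?thesis unfolding isomorphic_modules_def by (simp add: restrict_scalars_def)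
  qed
  \<comment> \<open>\<open>zero_or_maximal_generator\<close> supplies the premise
    \<open>generator\<close> for both kinds of \<open>P\<close>.\<close>
  have "virtually_simple_module ?E ?M"
    if P: "maximal_left_ideal P D \<or> P = {\<zero>\<^bsub>D\<^esub>}"
      and "isomorphic_modules ?E ?M (column_module n (left_quotient D P))" for P
  proof (rule MM.virtually_simple_if_iso_column[OF _ _ D.zero_or_maximal_generator[OF P] that(2)])
    show "left_ideal P D"
      using P by (auto intro: maximal_left_ideal.axioms(1) D.left_idealI)
    show "P \<noteq> carrier D"
      using P D.one_not_zero D.one_closed maximal_left_ideal.not_carrier by blast
  qed
  then show ?thesis
    unfolding iso M.virtually_simple_restrict_scalars[OF \<psi>(1) E.ring_axioms \<psi>(2), symmetric]
    using MM.virtually_simple_imp_iso_column[OF assms(3)] by blast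
qed

end
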